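(* Let $(Q,q)$ be a well-pointed quandle indexed by some set $I$, with graded fundamental group $\pi_1(Q,q)=\prod_{i\in I}\pi_1(Q,q_i)$. There exists a natural equivalence $\mathbf{Cov}_I(Q,q)\cong\mathbf{Sub}_I(\pi_1(Q,q))$ between the category of well-pointed coverings of $(Q,q)$ and the category of graded subgroups of $\pi_1(Q,q)$. Likewise, there exists a natural equivalence $\mathbf{Cov}(Q)\cong\mathbf{Act}(\pi_1(Q,q))$ between the category of coverings of $Q$ and the category of graded actions of $\pi_1(Q,q)$.
   Context: A quandle is a set $Q$ with two binary operations $*,\bar{*}$ such that for all $a,b,c\in Q$: $a*a=a$; $(a*b)\bar{*}b=a=(a\bar{*}b)*b$; $(a*b)*c=(a*c)*(b*c)$. A quandle homomorphism is a map preserving $*$ (hence $\bar{*}$). $\mathrm{Inn}(Q)$ is the group of automorphisms of $Q$ generated by the right translations $x\mapsto x*a$; the connected components of $Q$ are the orbits of $\mathrm{Inn}(Q)$. A well-pointed quandle $(Q,q)$ indexed by $I$ is a quandle $Q=\bigsqcup_{i\in I}Q_i$ where the $Q_i$ are exactly the (pairwise distinct) connected components, with a base point $q_i\in Q_i$ for each $i\in I$. A quandle homomorphism $p\colon\tilde Q\to Q$ is a covering if it is surjective and $p(\tilde y)=p(\tilde z)$ implies $\tilde x*\tilde y=\tilde x*\tilde z$ for all $\tilde x,\tilde y,\tilde z\in\tilde Q$. A morphism of coverings of $Q$ from $p\colon\tilde Q\to Q$ to $\hat p\colon\hat Q\to Q$ is a quandle homomorphism $\phi\colon\tilde Q\to\hat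 Q$ with $\hat p\circ\phi=p$; this gives the category $\mathbf{Cov}(Q)$. A well-pointed covering $p\colon(\tilde Q,\tilde q)\to(Q,q)$ is a covering with base points $\tilde q_i\in\tilde Q$, $p(\tilde q_i)=q_i$ for $i\in I$, such that each $\tilde Q_i=p^{-1}(Q_i)$ is a connected component of $\tilde Q$; with the covering morphisms preserving all base points these form the category $\mathbf{Cov}_I(Q,q)$. The adjoint group $\mathrm{Adj}(Q)$ is generated by symbols $\mathrm{adj}(a)$, $a\in Q$, subject to $\mathrm{adj}(a*b)=\mathrm{adj}(b)^{-1}\mathrm{adj}(a)\,\mathrm{adj}(b)$. It acts on $Q$ from the right with $a^{\mathrm{adj}(b)}=a*b$. Let $\varepsilon\colon\mathrm{Adj}(Q)\to\mathbb{Z}$ be the homomorphism with $\varepsilon(\mathrm{adj}(a))=1$ for all $a\in Q$, and $\mathrm{Adj}(Q)^\circ=\ker\varepsilon$. Set $\pi_1(Q,q_i)=\{g\in\mathrm{Adj}(Q)^\circ\mid q_i^g=q_i\}$. A graded subgroup of $G=\prod_{i\in I}G_i$ is a product $\prod_{i\in I}H_i$ of subgroups $H_i\subset G_i$; with inclusions as morphisms these form $\mathbf{Sub}_I(G)$. A graded action of $G=\prod_{i\in I}G_i$ on a graded set $X=\bigsqcup_{i\in I}X_i$ is a collection of right actions of $G_i$ on $X_i$, $i\in I$; morphisms are maps $\bigsqcup_iX_i\to\bigsqcup_iY_i$ sending each $X_i$ to $Y_i$ equivariantly. These form the category $\mathbf{Act}(G)$ of graded actions.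
   Formalization: Graded actions are required to have every X_i nonempty (coverings are surjective, so with empty X_i the second equivalence fails, e.g. for the one-element quandle); covering spaces and graded sets are subsets of an arbitrary infinite universe of cardinality at least |Q|. *)

theory Defs
  imports "HOL-Algebra.Bij" "HOL-Algebra.Generated_Groups" "HOL-Algebra.Product_Groups"
    "HOL-Library.Equipollence" "HOL-Library.Disjoint_Sets"
begin

section \<open>Categories and equivalences\<close>

text \<open>
  Morphisms live in hom-sets indexed by source and target, so one HOL value may occur in several
  hom-sets. \<open>Comp C X Y Z g f\<close> is the composite of \<open>f : X \<rightarrow> Y\<close> followed by \<open>g : Y \<rightarrow> Z\<close>.
\<close>

record ('o, 'm) cat =
  Obj :: "'o set"
  Hom :: "'o \<Rightarrow> 'o \<Rightarrow> 'm set"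
  Id :: "'o \<Rightarrow> 'm"
  Comp :: "'o \<Rightarrow> 'o \<Rightarrow> 'o \<Rightarrow> 'm \<Rightarrow> 'm \<Rightarrow> 'm"

locale category =
  fixes C :: "('o, 'm) cat"
  assumes Id_closed: "X \<in> Obj C \<Longrightarrow> Id C X \<in> Hom C X X"
    and Comp_closed:
      "\<lbrakk>X \<in> Obj C; Y \<in> Obj C; Z \<in> Obj C; f \<in> Hom C X Y; g \<in> Hom C Y Z\<rbrakk>
        \<Longrightarrow> Comp C X Y Z g f \<in> Hom C X Z"
    and Id_right: "\<lbrakk>X \<in> Obj C; Y \<in> Obj C; f \<in> Hom C X Y\<rbrakk> \<Longrightarrow> Comp C X X Y f (Id C X) = f"
    and Id_left: "\<lbrakk>X \<in> Obj C; Y \<in> Obj C; f \<in> Hom C X Y\<rbrakk> \<Longrightarrow> Comp C X Y Y (Id C Y) f = f"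
    and Comp_assoc:
      "\<lbrakk>X \<in> Obj C; Y \<in> Obj C; Z \<in> Obj C; W \<in> Obj C;
        f \<in> Hom C X Y; g \<in> Hom C Y Z; h \<in> Hom C Z W\<rbrakk>
        \<Longrightarrow> Comp C X Z W h (Comp C X Y Z g f) = Comp C X Y W (Comp C Y Z W h g) f"

record ('o, 'm, 'p, 'n) fctor =
  FObj :: "'o \<Rightarrow> 'p"
  FHom :: "'o \<Rightarrow> 'o \<Rightarrow> 'm \<Rightarrow> 'n"

locale is_functor = C: category C + D: category D
  for C :: "('o, 'm) cat" and D :: "('p, 'n) cat" +
  fixes F :: "('o, 'm, 'p, 'n) fctor"
  assumes FObj_closed: "X \<in> Obj C \<Longrightarrow> FObj F X \<in> Obj D"
    and FHom_closed: "\<lbrakk>X \<in> Obj C; Y \<in> Obj C; f \<in> Hom C X Y\<rbrakk>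
        \<Longrightarrow> FHom F X Y f \<in> Hom D (FObj F X) (FObj F Y)"
    and FHom_Id: "X \<in> Obj C \<Longrightarrow> FHom F X X (Id C X) = Id D (FObj F X)"
    and FHom_Comp:
      "\<lbrakk>X \<in> Obj C; Y \<in> Obj C; Z \<in> Obj C; f \<in> Hom C X Y; g \<in> Hom C Y Z\<rbrakk>
        \<Longrightarrow> FHom F X Z (Comp C X Y Z g f)
          = Comp D (FObj F X) (FObj F Y) (FObj F Z) (FHom F Y Z g) (FHom F X Y f)"

definition id_functor :: "('o, 'm, 'o, 'm) fctor" where
  "id_functor = \<lparr>FObj = (\<lambda>X. X), FHom = (\<lambda>X Y f. f)\<rparr>"

definition comp_functor ::
  "('p, 'n, 'q, 'l) fctor \<Rightarrow> ('o, 'm, 'p, 'n) fctor \<Rightarrow> ('o, 'm, 'q, 'l) fctor" where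
  "comp_functor G F =
    \<lparr>FObj = (\<lambda>X. FObj G (FObj F X)),
     FHom = (\<lambda>X Y f. FHom G (FObj F X) (FObj F Y) (FHom F X Y f))\<rparr>"

definition is_iso :: "('o, 'm) cat \<Rightarrow> 'o \<Rightarrow> 'o \<Rightarrow> 'm \<Rightarrow> bool" where
  "is_iso C X Y f \<longleftrightarrow> f \<in> Hom C X Y \<and>
    (\<exists>g \<in> Hom C Y X. Comp C X Y X g f = Id C X \<and> Comp C Y X Y f g = Id C Y)"

definition natural_iso ::
  "('o, 'm) cat \<Rightarrow> ('p, 'n) cat \<Rightarrow> ('o, 'm, 'p, 'n) fctor \<Rightarrow> ('o, 'm, 'p, 'n) fctor
    \<Rightarrow> ('o \<Rightarrow> 'n) \<Rightarrow> bool" where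
  "natural_iso C D F G \<eta> \<longleftrightarrow>
    (\<forall>X \<in> Obj C. is_iso D (FObj F X) (FObj G X) (\<eta> X)) \<and>
    (\<forall>X \<in> Obj C. \<forall>Y \<in> Obj C. \<forall>f \<in> Hom C X Y.
      Comp D (FObj F X) (FObj F Y) (FObj G Y) (\<eta> Y) (FHom F X Y f)
      = Comp D (FObj F X) (FObj G X) (FObj G Y) (FHom G X Y f) (\<eta> X))"

definition cat_equivalence ::
  "('o, 'm) cat \<Rightarrow> ('p, 'n) cat \<Rightarrow> ('o, 'm, 'p, 'n) fctor \<Rightarrow> ('p, 'n, 'o, 'm) fctor
    \<Rightarrow> ('o \<Rightarrow> 'm) \<Rightarrow> ('p \<Rightarrow> 'n) \<Rightarrow> bool" where
  "cat_equivalence C D F G \<eta> \<epsilon> \<longleftrightarrow>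
    is_functor C D F \<and> is_functor D C G \<and>
    natural_iso C C id_functor (comp_functor G F) \<eta> \<and>
    natural_iso D D (comp_functor F G) id_functor \<epsilon>"


section \<open>Quandles\<close>

record 'a quandle = "'a partial_object" +
  qop :: "'a \<Rightarrow> 'a \<Rightarrow> 'a" (infixl "\<triangleright>\<index>" 70)
  qbar :: "'a \<Rightarrow> 'a \<Rightarrow> 'a" (infixl "\<triangleleft>\<index>" 70)

locale quandle =
  fixes Q :: "('a, 'b) quandle_scheme" (structure)
  assumes qop_closed: "\<lbrakk>a \<in> carrier Q; b \<in> carrier Q\<rbrakk> \<Longrightarrow> a \<triangleright> b \<in> carrier Q"
    and qbar_closed: "\<lbrakk>a \<in> carrier Q; b \<in> carrier Q\<rbrakk> \<Longrightarrow> a \<triangleleft> b \<in> carrier Q"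
    and qop_idem: "a \<in> carrier Q \<Longrightarrow> a \<triangleright> a = a"
    and qop_qbar: "\<lbrakk>a \<in> carrier Q; b \<in> carrier Q\<rbrakk> \<Longrightarrow> (a \<triangleright> b) \<triangleleft> b = a"
    and qbar_qop: "\<lbrakk>a \<in> carrier Q; b \<in> carrier Q\<rbrakk> \<Longrightarrow> (a \<triangleleft> b) \<triangleright> b = a"
    and qop_distrib: "\<lbrakk>a \<in> carrier Q; b \<in> carrier Q; c \<in> carrier Q\<rbrakk>
        \<Longrightarrow> (a \<triangleright> b) \<triangleright> c = (a \<triangleright> c) \<triangleright> (b \<triangleright> c)"

text \<open>Homomorphisms are extensional, so that HOL equality is equality of maps on the carrier.\<close>

definition qhom :: "('a, 'b) quandle_scheme \<Rightarrow> ('c, 'd) quandle_scheme \<Rightarrow> ('a \<Rightarrow> 'c) set" where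
  "qhom Q R = {f \<in> carrier Q \<rightarrow>\<^sub>E carrier R.
    \<forall>x \<in> carrier Q. \<forall>y \<in> carrier Q. f (x \<triangleright>\<^bsub>Q\<^esub> y) = f x \<triangleright>\<^bsub>R\<^esub> f y}"

definition QAut :: "('a, 'b) quandle_scheme \<Rightarrow> ('a \<Rightarrow> 'a) monoid" where
  "QAut Q = BijGroup (carrier Q) \<lparr>carrier := qhom Q Q \<inter> Bij (carrier Q)\<rparr>"

definition Inn :: "('a, 'b) quandle_scheme \<Rightarrow> ('a \<Rightarrow> 'a) set" where
  "Inn Q = generate (QAut Q) {\<lambda>x \<in> carrier Q. x \<triangleright>\<^bsub>Q\<^esub> a | a. a \<in> carrier Q}"

definition qcomponents :: "('a, 'b) quandle_scheme \<Rightarrow> 'a set set" where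
  "qcomponents Q = {{f x | f. f \<in> Inn Q} | x. x \<in> carrier Q}"

definition well_pointed ::
  "('a, 'b) quandle_scheme \<Rightarrow> 'i set \<Rightarrow> ('i \<Rightarrow> 'a set) \<Rightarrow> ('i \<Rightarrow> 'a) \<Rightarrow> bool" where
  "well_pointed Q I Qc q \<longleftrightarrow>
    quandle Q \<and> bij_betw Qc I (qcomponents Q) \<and> (\<forall>i \<in> I. q i \<in> Qc i)"


section \<open>The adjoint group and the fundamental group\<close>

text \<open>
  The presentation of the adjoint group: words in the letters \<open>(True, a)\<close>, standing for the
  generator \<open>adj(a)\<close>, and \<open>(False, a)\<close>, standing for its formal inverse, modulo the congruence
  generated by free cancellation and the defining relations.
\<close>

definition adj_words :: "('a, 'b) quandle_scheme \<Rightarrow> (bool \<times> 'a) list set" where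
  "adj_words Q = lists (UNIV \<times> carrier Q)"

inductive adj_eq ::
  "('a, 'b) quandle_scheme \<Rightarrow> (bool \<times> 'a) list \<Rightarrow> (bool \<times> 'a) list \<Rightarrow> bool"
  for Q :: "('a, 'b) quandle_scheme" where
  refl: "u \<in> adj_words Q \<Longrightarrow> adj_eq Q u u"
| sym: "adj_eq Q u v \<Longrightarrow> adj_eq Q v u"
| trans: "\<lbrakk>adj_eq Q u v; adj_eq Q v w\<rbrakk> \<Longrightarrow> adj_eq Q u w"
| cong: "\<lbrakk>adj_eq Q u u'; adj_eq Q v v'\<rbrakk> \<Longrightarrow> adj_eq Q (u @ v) (u' @ v')"
| cancel_right: "a \<in> carrier Q \<Longrightarrow> adj_eq Q [(True, a), (False, a)] []"
| cancel_left: "a \<in> carrier Q \<Longrightarrow> adj_eq Q [(False, a), (True, a)] []"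
| relator: "\<lbrakk>a \<in> carrier Q; b \<in> carrier Q\<rbrakk>
    \<Longrightarrow> adj_eq Q [(True, a \<triangleright>\<^bsub>Q\<^esub> b)] [(False, b), (True, a), (True, b)]"

definition adj_class :: "('a, 'b) quandle_scheme \<Rightarrow> (bool \<times> 'a) list \<Rightarrow> (bool \<times> 'a) list set" where
  "adj_class Q w = {v. adj_eq Q w v}"

definition Adj :: "('a, 'b) quandle_scheme \<Rightarrow> (bool \<times> 'a) list set monoid" where
  "Adj Q =
    \<lparr>carrier = adj_class Q ` adj_words Q,
     mult = (\<lambda>g h. \<Union>u \<in> g. \<Union>v \<in> h. adj_class Q (u @ v)),
     one = adj_class Q []\<rparr>"

text \<open>
  Maps out of the adjoint group are given on words; being invariant under \<open>adj_eq\<close>, they take a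
  single value on each class, which is extracted by \<open>the_elem\<close>.
\<close>

definition adj_act :: "('a, 'b) quandle_scheme \<Rightarrow> 'a \<Rightarrow> (bool \<times> 'a) list set \<Rightarrow> 'a" where
  "adj_act Q x g = the_elem
    (foldl (\<lambda>y (s, a). if s then y \<triangleright>\<^bsub>Q\<^esub> a else y \<triangleleft>\<^bsub>Q\<^esub> a) x ` g)"

definition adj_eps :: "(bool \<times> 'a) list set \<Rightarrow> int" where
  "adj_eps g = the_elem ((\<lambda>w. \<Sum>(s, a)\<leftarrow>w. if s then 1 else - 1) ` g)"

definition adj_map ::
  "('c, 'd) quandle_scheme \<Rightarrow> ('a, 'b) quandle_scheme \<Rightarrow> ('c \<Rightarrow> 'a)
    \<Rightarrow> (bool \<times> 'c) list set \<Rightarrow> (bool \<times> 'a) list set" where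
  "adj_map R Q p g = the_elem ((\<lambda>w. adj_class Q (map (map_prod id p) w)) ` g)"

definition fundamental_group ::
  "('a, 'b) quandle_scheme \<Rightarrow> 'a \<Rightarrow> (bool \<times> 'a) list set monoid" ("\<pi>\<^sub>1") where
  "\<pi>\<^sub>1 Q x = Adj Q \<lparr>carrier :=
    {g \<in> kernel (Adj Q) integer_group adj_eps. adj_act Q x g = x}\<rparr>"


section \<open>Categories of coverings\<close>

text \<open>The total space of a covering is carried by a subset of the universe type \<open>'u\<close>.\<close>

record ('u, 'a) covering =
  total :: "'u quandle"
  proj :: "'u \<Rightarrow> 'a"

record ('u, 'a, 'i) pointed_covering = "('u, 'a) covering" +
  base :: "'i \<Rightarrow> 'u"

definition is_covering ::
  "('a, 'b) quandle_scheme \<Rightarrow> ('u, 'a, 'x) covering_scheme \<Rightarrow> bool" where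
  "is_covering Q P \<longleftrightarrow>
    quandle Q \<and> quandle (total P) \<and> proj P \<in> qhom (total P) Q \<and>
    proj P ` carrier (total P) = carrier Q \<and>
    (\<forall>x \<in> carrier (total P). \<forall>y \<in> carrier (total P). \<forall>z \<in> carrier (total P).
      proj P y = proj P z \<longrightarrow> x \<triangleright>\<^bsub>total P\<^esub> y = x \<triangleright>\<^bsub>total P\<^esub> z)"

definition covering_hom ::
  "('u, 'a, 'x) covering_scheme \<Rightarrow> ('u, 'a, 'x) covering_scheme \<Rightarrow> ('u \<Rightarrow> 'u) set" where
  "covering_hom P P' = {\<phi> \<in> qhom (total P) (total P').
    \<forall>x \<in> carrier (total P). proj P' (\<phi> x) = proj P x}"

definition Cov :: "('a, 'b) quandle_scheme \<Rightarrow> (('u, 'a) covering, 'u \<Rightarrow> 'u) cat" where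
  "Cov Q =
    \<lparr>Obj = {P. is_covering Q P},
     Hom = covering_hom,
     Id = (\<lambda>P. \<lambda>x \<in> carrier (total P). x),
     Comp = (\<lambda>P P' P'' \<psi> \<phi>. compose (carrier (total P)) \<psi> \<phi>)\<rparr>"

definition is_pointed_covering ::
  "('a, 'b) quandle_scheme \<Rightarrow> 'i set \<Rightarrow> ('i \<Rightarrow> 'a set) \<Rightarrow> ('i \<Rightarrow> 'a)
    \<Rightarrow> ('u, 'a, 'i) pointed_covering \<Rightarrow> bool" where
  "is_pointed_covering Q I Qc q P \<longleftrightarrow>
    is_covering Q P \<and> base P \<in> I \<rightarrow>\<^sub>E carrier (total P) \<and>
    (\<forall>i \<in> I. proj P (base P i) = q i) \<and>
    (\<forall>i \<in> I. {x \<in> carrier (total P). proj P x \<in> Qc i} \<in> qcomponents (total P))"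

definition Cov_I ::
  "('a, 'b) quandle_scheme \<Rightarrow> 'i set \<Rightarrow> ('i \<Rightarrow> 'a set) \<Rightarrow> ('i \<Rightarrow> 'a)
    \<Rightarrow> (('u, 'a, 'i) pointed_covering, 'u \<Rightarrow> 'u) cat" where
  "Cov_I Q I Qc q =
    \<lparr>Obj = {P. is_pointed_covering Q I Qc q P},
     Hom = (\<lambda>P P'. {\<phi> \<in> covering_hom P P'. \<forall>i \<in> I. \<phi> (base P i) = base P' i}),
     Id = (\<lambda>P. \<lambda>x \<in> carrier (total P). x),
     Comp = (\<lambda>P P' P'' \<psi> \<phi>. compose (carrier (total P)) \<psi> \<phi>)\<rparr>"


section \<open>Graded subgroups and graded actions\<close>

text \<open>
  A graded group \<open>\<Prod>i\<in>I. G i\<close> is given by its family of factors; graded subgroups are subsets of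
  the carrier of \<open>product_group I G\<close>.
\<close>

definition Sub_I ::
  "'i set \<Rightarrow> ('i \<Rightarrow> 'g monoid) \<Rightarrow> (('i \<Rightarrow> 'g) set, ('i \<Rightarrow> 'g) \<Rightarrow> ('i \<Rightarrow> 'g)) cat" where
  "Sub_I I G =
    \<lparr>Obj = {\<Pi>\<^sub>E i\<in>I. H i | H. \<forall>i \<in> I. subgroup (H i) (G i)},
     Hom = (\<lambda>K L. if K \<subseteq> L then {\<lambda>x \<in> K. x} else {}),
     Id = (\<lambda>K. \<lambda>x \<in> K. x),
     Comp = (\<lambda>K L M g f. compose K g f)\<rparr>"

record ('i, 'u, 'g) graded_action =
  piece :: "'i \<Rightarrow> 'u set"
  act :: "'i \<Rightarrow> 'u \<Rightarrow> 'g \<Rightarrow> 'u"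

text \<open>
  The pieces of a graded set are nonempty. This is forced by the requirement that coverings be
  surjective: over a one-element quandle, coverings are nonempty sets, whereas admitting an empty
  piece would give the category of actions an initial object.
\<close>

definition is_graded_action ::
  "'i set \<Rightarrow> ('i \<Rightarrow> 'g monoid) \<Rightarrow> ('i, 'u, 'g) graded_action \<Rightarrow> bool" where
  "is_graded_action I G X \<longleftrightarrow>
    (\<forall>i \<in> I. group (G i)) \<and>
    disjoint_family_on (piece X) I \<and>
    (\<forall>i \<in> I. piece X i \<noteq> {} \<and>
      (\<forall>x \<in> piece X i. \<forall>g \<in> carrier (G i). act X i x g \<in> piece X i) \<and>
      (\<forall>x \<in> piece X i. act X i x \<one>\<^bsub>G i\<^esub> = x) \<and>
      (\<forall>x \<in> piece X i. \<forall>g \<in> carrier (G i). \<forall>h \<in> carrier (G i).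
        act X i x (g \<otimes>\<^bsub>G i\<^esub> h) = act X i (act X i x g) h))"

definition graded_action_hom ::
  "'i set \<Rightarrow> ('i \<Rightarrow> 'g monoid) \<Rightarrow> ('i, 'u, 'g) graded_action \<Rightarrow> ('i, 'u, 'g) graded_action
    \<Rightarrow> ('u \<Rightarrow> 'u) set" where
  "graded_action_hom I G X Y =
    {f \<in> (\<Union>i\<in>I. piece X i) \<rightarrow>\<^sub>E (\<Union>i\<in>I. piece Y i).
      \<forall>i \<in> I. \<forall>x \<in> piece X i. f x \<in> piece Y i \<and>
        (\<forall>g \<in> carrier (G i). f (act X i x g) = act Y i (f x) g)}"

definition Act_I ::
  "'i set \<Rightarrow> ('i \<Rightarrow> 'g monoid) \<Rightarrow> (('i, 'u, 'g) graded_action, 'u \<Rightarrow> 'u) cat" where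
  "Act_I I G =
    \<lparr>Obj = {X. is_graded_action I G X},
     Hom = graded_action_hom I G,
     Id = (\<lambda>X. \<lambda>x \<in> (\<Union>i\<in>I. piece X i). x),
     Comp = (\<lambda>X Y Z g f. compose (\<Union>i\<in>I. piece X i) g f)\<rparr>"


section \<open>The canonical functors\<close>

text \<open>A well-pointed covering \<open>p\<close> is sent to the image of its graded fundamental group under \<open>p\<close>.\<close>

definition image_functor ::
  "('a, 'b) quandle_scheme \<Rightarrow> 'i set \<Rightarrow>
    (('u, 'a, 'i) pointed_covering, 'u \<Rightarrow> 'u,
     ('i \<Rightarrow> (bool \<times> 'a) list set) set,
     ('i \<Rightarrow> (bool \<times> 'a) list set) \<Rightarrow> ('i \<Rightarrow> (bool \<times> 'a) list set)) fctor" where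
  "image_functor Q I =
    (let im = (\<lambda>P. \<Pi>\<^sub>E i\<in>I. adj_map (total P) Q (proj P) ` carrier (\<pi>\<^sub>1 (total P) (base P i)))
     in \<lparr>FObj = im, FHom = (\<lambda>P P' \<phi>. \<lambda>x \<in> im P. x)\<rparr>)"

text \<open>
  Monodromy: \<open>g\<close> in the adjoint group of the base acts on the total space of a covering through
  any lift \<open>h\<close> of \<open>g\<close> to the adjoint group of the total space. For a covering such a lift exists
  and its action depends only on \<open>g\<close>.
\<close>

definition monodromy ::
  "('a, 'b) quandle_scheme \<Rightarrow> ('u, 'a, 'x) covering_scheme \<Rightarrow> 'u \<Rightarrow> (bool \<times> 'a) list set \<Rightarrow> 'u" where
  "monodromy Q P x g = (THE y. \<exists>h \<in> carrier (Adj (total P)).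
    adj_map (total P) Q (proj P) h = g \<and> y = adj_act (total P) x h)"

definition fibre :: "('u, 'a, 'x) covering_scheme \<Rightarrow> 'a \<Rightarrow> 'u set" where
  "fibre P a = {x \<in> carrier (total P). proj P x = a}"

definition fibre_functor ::
  "('a, 'b) quandle_scheme \<Rightarrow> 'i set \<Rightarrow> ('i \<Rightarrow> 'a) \<Rightarrow>
    (('u, 'a) covering, 'u \<Rightarrow> 'u,
     ('i, 'u, (bool \<times> 'a) list set) graded_action, 'u \<Rightarrow> 'u) fctor" where
  "fibre_functor Q I q =
    \<lparr>FObj = (\<lambda>P. \<lparr>piece = (\<lambda>i. fibre P (q i)), act = (\<lambda>i. monodromy Q P)\<rparr>),
     FHom = (\<lambda>P P' \<phi>. restrict \<phi> (\<Union>i\<in>I. fibre P (q i)))\<rparr>"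

end

theory Submission
  imports Defs "HOL-Algebra.Coset"
begin

text \<open>
  Everything rests on one translation: a covering of \<open>Q\<close> is the same thing as a set \<open>X\<close> with a
  right action of \<open>Adj(Q)\<close> and an equivariant surjection \<open>p : X \<rightarrow> Q\<close> such that
  \<open>x\<cdot>adj(p x) = x\<close> for all \<open>x\<close>. Given a covering, \<open>x * y\<close> depends only on the image of \<open>y\<close>, so the
  generators of \<open>Adj(Q)\<close> act on the total space, and the defining relators act trivially; this is
  the monodromy action (\<open>monodromy_class\<close>, \<open>proj_monodromy\<close>, \<open>monodromy_adj_self\<close>). Conversely
  \<open>x * y = x\<cdot>adj(p y)\<close> defines a covering (\<open>covering_of_action\<close>). Morphisms of coverings are the
  equivariant maps over \<open>Q\<close>, and connected components are orbits (\<open>qcomponents_eq_orbits\<close>).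

  An \<open>Adj(Q)\<close>-set over \<open>Q\<close> is determined by its fibres over the base points \<open>q\<^sub>i\<close>, one in each orbit,
  together with the actions of their stabilisers. Since \<open>g\<inverse> adj(a) g = adj(a\<^sup>g)\<close>, the element
  \<open>adj(q\<^sub>i)\<close> is central in the stabiliser of \<open>q\<^sub>i\<close>. As \<open>\<epsilon>(adj(q\<^sub>i)) = 1\<close>, this stabiliser is the direct
  product of \<open>\<pi>\<^sub>1(Q, q\<^sub>i) = ker \<epsilon> \<inter> Stab(q\<^sub>i)\<close> and the infinite cyclic group generated by \<open>adj(q\<^sub>i)\<close>;
  the projection to the first factor is \<open>loop_part\<close>. The condition \<open>x\<cdot>adj(p x) = x\<close> says that the
  second factor acts trivially on the fibre, so a fibre is just a \<open>\<pi>\<^sub>1(Q, q\<^sub>i)\<close>-set.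

  Thus taking fibres is faithful (\<open>covering_hom_eqI\<close>: every point lies on the \<open>Adj(Q)\<close>-orbit of a
  point over some \<open>q\<^sub>i\<close>), full (\<open>fibre_map_extends\<close>: transport to the base fibre, map, transport
  back), and essentially surjective (\<open>induced_covering\<close>: the induced action, on pairs \<open>(x, a)\<close> with
  \<open>x\<close> in the fibre belonging to the component of \<open>a\<close>). For well-pointed coverings the fibres are
  transitive and pointed, and the image of the fundamental group of the covering is the stabiliser
  of the base point of the fibre (\<open>image_eq_stabilizer\<close>). A morphism of pointed transitive sets is
  unique, and exists exactly when the stabiliser of the source is contained in that of the target;
  every subgroup is the stabiliser of the trivial coset.

  The cardinality hypotheses make room in the universe \<open>'u\<close> for the pairs \<open>(x, a)\<close> and for the cosets
  in \<open>\<pi>\<^sub>1(Q, q\<^sub>i)\<close>.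
\<close>

section \<open>An equivalence criterion\<close>

text \<open>
  The quasi-inverse picks, for each object \<open>Z\<close> of \<open>D\<close>, an object \<open>Go Z\<close> of \<open>C\<close> with an isomorphism
  \<open>e Z : F(Go Z) \<rightarrow> Z\<close>. A morphism \<open>k : Y \<rightarrow> Z\<close> is first conjugated by these isomorphisms, giving
  \<open>tr Y Z k\<close>, and then lifted along the full functor \<open>F\<close>. All identities required of the lifts are
  checked after applying \<open>F\<close>, which suffices by faithfulness.
\<close>

theorem (in is_functor) equivalence_if_fully_faithful_ess_surj:
  assumes faithful: "\<And>X Y f g. \<lbrakk>X \<in> Obj C; Y \<in> Obj C; f \<in> Hom C X Y; g \<in> Hom C X Y;
      FHom F X Y f = FHom F X Y g\<rbrakk> \<Longrightarrow> f = g"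
    and full: "\<And>X Y h. \<lbrakk>X \<in> Obj C; Y \<in> Obj C; h \<in> Hom D (FObj F X) (FObj F Y)\<rbrakk>
      \<Longrightarrow> \<exists>f \<in> Hom C X Y. FHom F X Y f = h"
    and ess_surj: "\<And>Z. Z \<in> Obj D \<Longrightarrow> \<exists>X \<in> Obj C. \<exists>e. is_iso D (FObj F X) Z e"
  shows "\<exists>G \<eta> \<epsilon>. cat_equivalence C D F G \<eta> \<epsilon>"
proof -
  let ?F = "FObj F"
  obtain Go e where Go: "\<And>Z. Z \<in> Obj D \<Longrightarrow> Go Z \<in> Obj C"
    and e_iso: "\<And>Z. Z \<in> Obj D \<Longrightarrow> is_iso D (?F (Go Z)) Z (e Z)"
    using ess_surj by metis
  from e_iso have e: "\<And>Z. Z \<in> Obj D \<Longrightarrow> e Z \<in> Hom D (?F (Go Z)) Z"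
    by (simp add: is_iso_def)
  from e_iso have "\<forall>Z \<in> Obj D. \<exists>e'. e' \<in> Hom D Z (?F (Go Z)) \<and>
      Comp D (?F (Go Z)) Z (?F (Go Z)) e' (e Z) = Id D (?F (Go Z)) \<and>
      Comp D Z (?F (Go Z)) Z (e Z) e' = Id D Z"
    unfolding is_iso_def by blast
  then obtain e' where e': "\<And>Z. Z \<in> Obj D \<Longrightarrow> e' Z \<in> Hom D Z (?F (Go Z))"
    and e'e: "\<And>Z. Z \<in> Obj D \<Longrightarrow> Comp D (?F (Go Z)) Z (?F (Go Z)) (e' Z) (e Z) = Id D (?F (Go Z))"
    and ee': "\<And>Z. Z \<in> Obj D \<Longrightarrow> Comp D Z (?F (Go Z)) Z (e Z) (e' Z) = Id D Z"
    by metis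
  define lift where "lift X Y h = (SOME f. f \<in> Hom C X Y \<and> FHom F X Y f = h)" for X Y h
  have lift: "lift X Y h \<in> Hom C X Y" "FHom F X Y (lift X Y h) = h"
    if "X \<in> Obj C" "Y \<in> Obj C" "h \<in> Hom D (?F X) (?F Y)" for X Y h
    using someI_ex[of "\<lambda>f. f \<in> Hom C X Y \<and> FHom F X Y f = h"] full[OF that]
    unfolding lift_def by blast+
  define tr where "tr Y Z k = Comp D (?F (Go Y)) Z (?F (Go Z)) (e' Z) (Comp D (?F (Go Y)) Y Z k (e Y))"
    for Y Z k
  have tr: "tr Y Z k \<in> Hom D (?F (Go Y)) (?F (Go Z))"
    if "Y \<in> Obj D" "Z \<in> Obj D" "k \<in> Hom D Y Z" for Y Z k
    unfolding tr_def using that e e' Go FObj_closed by (blast intro: D.Comp_closed)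
  have e_tr: "Comp D (?F (Go Y)) (?F (Go Z)) Z (e Z) (tr Y Z k) = Comp D (?F (Go Y)) Y Z k (e Y)"
    if YZ: "Y \<in> Obj D" "Z \<in> Obj D" "k \<in> Hom D Y Z" for Y Z k
  proof -
    let ?h = "Comp D (?F (Go Y)) Y Z k (e Y)"
    have h: "?h \<in> Hom D (?F (Go Y)) Z"
      using YZ e Go FObj_closed by (blast intro: D.Comp_closed)
    have "Comp D (?F (Go Y)) (?F (Go Z)) Z (e Z) (tr Y Z k)
        = Comp D (?F (Go Y)) Z Z (Comp D Z (?F (Go Z)) Z (e Z) (e' Z)) ?h"
      unfolding tr_def using YZ h e e' Go FObj_closed by (intro D.Comp_assoc) auto
    then show ?thesis
      using YZ h Go FObj_closed by (simp add: ee' D.Id_left)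
  qed
  \<comment> \<open>Every property of \<open>tr\<close> below comes from this: since \<open>e Z\<close> is invertible, \<open>tr Y Z k\<close> is the only
    morphism that makes the naturality square of \<open>e\<close> commute.\<close>
  have tr_unique: "k' = tr Y Z k"
    if "Y \<in> Obj D" "Z \<in> Obj D" "k \<in> Hom D Y Z" "k' \<in> Hom D (?F (Go Y)) (?F (Go Z))"
      "Comp D (?F (Go Y)) (?F (Go Z)) Z (e Z) k' = Comp D (?F (Go Y)) Y Z k (e Y)" for Y Z k k'
  proof -
    have "tr Y Z k = Comp D (?F (Go Y)) (?F (Go Z)) (?F (Go Z))
        (Comp D (?F (Go Z)) Z (?F (Go Z)) (e' Z) (e Z)) k'"
      unfolding tr_def that(5)[symmetric] using that e e' Go FObj_closed
      by (intro D.Comp_assoc) auto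
    then show ?thesis
      using that Go FObj_closed by (simp add: e'e D.Id_left)
  qed
  have tr_Id: "tr Y Y (Id D Y) = Id D (?F (Go Y))" if "Y \<in> Obj D" for Y
    using that e Go FObj_closed
    by (intro tr_unique[symmetric]) (auto simp: D.Id_closed D.Id_left D.Id_right)
  have tr_Comp: "tr X Z (Comp D X Y Z k h)
      = Comp D (?F (Go X)) (?F (Go Y)) (?F (Go Z)) (tr Y Z k) (tr X Y h)"
    if XYZ: "X \<in> Obj D" "Y \<in> Obj D" "Z \<in> Obj D" "h \<in> Hom D X Y" "k \<in> Hom D Y Z" for X Y Z h k
  proof (rule tr_unique[symmetric])
    note cl = XYZ e Go FObj_closed tr
    have "Comp D (?F (Go X)) (?F (Go Z)) Z (e Z)
          (Comp D (?F (Go X)) (?F (Go Y)) (?F (Go Z)) (tr Y Z k) (tr X Y h))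
        = Comp D (?F (Go X)) (?F (Go Y)) Z (Comp D (?F (Go Y)) (?F (Go Z)) Z (e Z) (tr Y Z k)) (tr X Y h)"
      using cl by (intro D.Comp_assoc) auto
    also have "\<dots> = Comp D (?F (Go X)) (?F (Go Y)) Z (Comp D (?F (Go Y)) Y Z k (e Y)) (tr X Y h)"
      using XYZ by (simp add: e_tr)
    also have "\<dots> = Comp D (?F (Go X)) Y Z k (Comp D (?F (Go X)) (?F (Go Y)) Y (e Y) (tr X Y h))"
      using cl by (intro D.Comp_assoc[symmetric]) auto
    also have "\<dots> = Comp D (?F (Go X)) Y Z k (Comp D (?F (Go X)) X Y h (e X))"
      using XYZ by (simp add: e_tr)
    also have "\<dots> = Comp D (?F (Go X)) X Z (Comp D X Y Z k h) (e X)"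
      using cl by (intro D.Comp_assoc) auto
    finally show "Comp D (?F (Go X)) (?F (Go Z)) Z (e Z)
          (Comp D (?F (Go X)) (?F (Go Y)) (?F (Go Z)) (tr Y Z k) (tr X Y h))
        = Comp D (?F (Go X)) X Z (Comp D X Y Z k h) (e X)" .
  qed (use XYZ Go FObj_closed tr in \<open>auto intro: D.Comp_closed\<close>)
  define G where "G = \<lparr>FObj = Go, FHom = (\<lambda>Y Z k. lift (Go Y) (Go Z) (tr Y Z k))\<rparr>"
  have G_simps [simp]: "FObj G = Go" "FHom G = (\<lambda>Y Z k. lift (Go Y) (Go Z) (tr Y Z k))"
    by (simp_all add: G_def)
  have G_functor: "is_functor D C G"
  proof unfold_locales
    fix Y assume Y: "Y \<in> Obj D"
    then show "FObj G Y \<in> Obj C" by (simp add: Go)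
    show "FHom G Y Y (Id D Y) = Id C (FObj G Y)"
      using Y by (intro faithful[of "Go Y" "Go Y"])
        (auto simp: Go lift tr FHom_Id C.Id_closed D.Id_closed FObj_closed tr_Id)
  next
    fix Y Z k assume YZ: "Y \<in> Obj D" "Z \<in> Obj D" "k \<in> Hom D Y Z"
    then show "FHom G Y Z k \<in> Hom C (FObj G Y) (FObj G Z)" by (simp add: Go lift tr)
  next
    fix X Y Z h k
    assume XYZ: "X \<in> Obj D" "Y \<in> Obj D" "Z \<in> Obj D" "h \<in> Hom D X Y" "k \<in> Hom D Y Z"
    then have cl: "Go X \<in> Obj C" "Go Y \<in> Obj C" "Go Z \<in> Obj C"
        "Comp D X Y Z k h \<in> Hom D X Z"
        "lift (Go X) (Go Y) (tr X Y h) \<in> Hom C (Go X) (Go Y)"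
        "lift (Go Y) (Go Z) (tr Y Z k) \<in> Hom C (Go Y) (Go Z)"
      by (auto simp: Go lift tr D.Comp_closed)
    show "FHom G X Z (Comp D X Y Z k h)
        = Comp C (FObj G X) (FObj G Y) (FObj G Z) (FHom G Y Z k) (FHom G X Y h)"
      using XYZ cl C.Comp_closed[OF cl(1-3) cl(5,6)]
      by (intro faithful[of "Go X" "Go Z"])
        (auto simp: lift tr FHom_Comp tr_Comp D.Comp_closed FObj_closed)
  qed
  define \<eta> where "\<eta> X = lift X (Go (?F X)) (e' (?F X))" for X
  have \<eta>: "\<eta> X \<in> Hom C X (Go (?F X))" "FHom F X (Go (?F X)) (\<eta> X) = e' (?F X)"
    if "X \<in> Obj C" for X
    unfolding \<eta>_def using that by (auto intro!: lift Go FObj_closed e')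
  have \<eta>_iso: "is_iso C X (Go (?F X)) (\<eta> X)" if X: "X \<in> Obj C" for X
  proof -
    let ?Y = "Go (?F X)" and ?g = "lift (Go (?F X)) X (e (?F X))"
    have Y: "?Y \<in> Obj C" using X by (simp add: Go FObj_closed)
    have g: "?g \<in> Hom C ?Y X" "FHom F ?Y X ?g = e (?F X)"
      using X Y by (auto intro!: lift e FObj_closed)
    have "Comp C X ?Y X ?g (\<eta> X) = Id C X"
      using X Y g \<eta> C.Comp_closed[OF X Y X \<eta>(1)[OF X] g(1)]
      by (intro faithful[of X X]) (auto simp: FHom_Comp FHom_Id ee' FObj_closed C.Id_closed)
    moreover have "Comp C ?Y X ?Y (\<eta> X) ?g = Id C ?Y"
      using X Y g \<eta> C.Comp_closed[OF Y X Y g(1) \<eta>(1)[OF X]]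
      by (intro faithful[of ?Y ?Y]) (auto simp: FHom_Comp FHom_Id e'e FObj_closed C.Id_closed)
    ultimately show ?thesis unfolding is_iso_def using g \<eta> X by blast
  qed
  have \<eta>_nat: "Comp C X Y (Go (?F Y)) (\<eta> Y) f
      = Comp C X (Go (?F X)) (Go (?F Y)) (lift (Go (?F X)) (Go (?F Y)) (tr (?F X) (?F Y) (FHom F X Y f))) (\<eta> X)"
    if XY: "X \<in> Obj C" "Y \<in> Obj C" "f \<in> Hom C X Y" for X Y f
  proof -
    let ?X' = "Go (?F X)" and ?Y' = "Go (?F Y)" and ?k = "FHom F X Y f"
    let ?l = "lift ?X' ?Y' (tr (?F X) (?F Y) ?k)"
    have o: "?X' \<in> Obj C" "?Y' \<in> Obj C" "?F X \<in> Obj D" "?F Y \<in> Obj D" "?F ?X' \<in> Obj D" "?F ?Y' \<in> Obj D"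
      using XY by (simp_all add: Go FObj_closed)
    have k: "?k \<in> Hom D (?F X) (?F Y)" using XY by (rule FHom_closed)
    have l: "?l \<in> Hom C ?X' ?Y'" "FHom F ?X' ?Y' ?l = tr (?F X) (?F Y) ?k"
      using o k by (auto intro!: lift tr)
    have ek: "Comp D (?F ?X') (?F X) (?F Y) ?k (e (?F X)) \<in> Hom D (?F ?X') (?F Y)"
      using o k e by (auto intro!: D.Comp_closed)
    have "Comp D (?F X) (?F ?X') (?F ?Y') (tr (?F X) (?F Y) ?k) (e' (?F X))
        = Comp D (?F X) (?F Y) (?F ?Y') (e' (?F Y))
            (Comp D (?F X) (?F ?X') (?F Y) (Comp D (?F ?X') (?F X) (?F Y) ?k (e (?F X))) (e' (?F X)))"
      unfolding tr_def using o k ek e e' by (intro D.Comp_assoc[symmetric]) auto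
    also have "Comp D (?F X) (?F ?X') (?F Y) (Comp D (?F ?X') (?F X) (?F Y) ?k (e (?F X))) (e' (?F X))
        = Comp D (?F X) (?F X) (?F Y) ?k (Comp D (?F X) (?F ?X') (?F X) (e (?F X)) (e' (?F X)))"
      using o k e e' by (intro D.Comp_assoc[symmetric]) auto
    also have "\<dots> = ?k"
      using o k by (simp add: ee' D.Id_right)
    finally have "Comp D (?F X) (?F ?X') (?F ?Y') (tr (?F X) (?F Y) ?k) (e' (?F X))
        = Comp D (?F X) (?F Y) (?F ?Y') (e' (?F Y)) ?k" .
    then show ?thesis
      using XY o l \<eta>[OF XY(1)] \<eta>[OF XY(2)] C.Comp_closed[OF XY(1) o(1,2) \<eta>(1)[OF XY(1)] l(1)]
        C.Comp_closed[OF XY(1,2) o(2) XY(3) \<eta>(1)[OF XY(2)]]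
      by (intro faithful[of X ?Y']) (auto simp: FHom_Comp)
  qed
  have "cat_equivalence C D F G \<eta> e"
    unfolding cat_equivalence_def natural_iso_def
    using is_functor_axioms G_functor e_iso \<eta>_iso \<eta>_nat e_tr
    by (auto simp: id_functor_def comp_functor_def lift tr Go)
  then show ?thesis by blast
qed

section \<open>Right actions\<close>

text \<open>
  Together with associativity oriented to the right, these rules bring words in a group to a normal form.
\<close>

lemma (in group) cancel_inv:
  assumes "x \<in> carrier G" "y \<in> carrier G"
  shows "x \<otimes> (inv x \<otimes> y) = y" "inv x \<otimes> (x \<otimes> y) = y"
  using assms by (simp_all flip: m_assoc)

locale right_action = group G for G :: "('g, 'b) monoid_scheme" (structure) +
  fixes X :: "'x set" and \<alpha> :: "'x \<Rightarrow> 'g \<Rightarrow> 'x"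
  assumes act_closed: "\<lbrakk>x \<in> X; g \<in> carrier G\<rbrakk> \<Longrightarrow> \<alpha> x g \<in> X"
    and act_one: "x \<in> X \<Longrightarrow> \<alpha> x \<one> = x"
    and act_mult: "\<lbrakk>x \<in> X; g \<in> carrier G; h \<in> carrier G\<rbrakk> \<Longrightarrow> \<alpha> x (g \<otimes> h) = \<alpha> (\<alpha> x g) h"
begin

lemma act_inv_right: "\<lbrakk>x \<in> X; g \<in> carrier G\<rbrakk> \<Longrightarrow> \<alpha> (\<alpha> x g) (inv g) = x"
  by (simp flip: act_mult add: act_one)

lemma act_inv_left: "\<lbrakk>x \<in> X; g \<in> carrier G\<rbrakk> \<Longrightarrow> \<alpha> (\<alpha> x (inv g)) g = x"
  by (simp flip: act_mult add: act_one)

definition stabilizer :: "'x \<Rightarrow> 'g set" where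
  "stabilizer x = {g \<in> carrier G. \<alpha> x g = x}"

lemma stabilizer_subgroup:
  assumes "x \<in> X" shows "subgroup (stabilizer x) G"
proof (rule subgroupI)
  show "stabilizer x \<noteq> {}" using assms act_one by (auto simp: stabilizer_def)
  show "inv g \<in> stabilizer x" if "g \<in> stabilizer x" for g
    using that assms act_inv_right[of x g] by (auto simp: stabilizer_def)
qed (use assms in \<open>auto simp: stabilizer_def act_mult\<close>)

text \<open>
  The substitutions \<open>h \<mapsto> g h\<close> and \<open>h \<mapsto> g\<inverse> h\<close> turn each orbit into the other.
\<close>

lemma orbit_eqI:
  assumes "x \<in> X" "y \<in> X" "g \<in> carrier G" "\<alpha> x g = y"
  shows "\<alpha> x ` carrier G = \<alpha> y ` carrier G"
proof -
  have 1: "\<alpha> y h = \<alpha> x (g \<otimes> h)" if "h \<in> carrier G" for h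
    using that assms by (simp add: act_mult)
  have 2: "\<alpha> x h = \<alpha> y (inv g \<otimes> h)" if "h \<in> carrier G" for h
    using that assms(1,3) by (simp add: act_mult act_inv_right act_closed flip: assms(4))
  show ?thesis
  proof (rule antisym; rule image_subsetI)
    show "\<alpha> x h \<in> \<alpha> y ` carrier G" if "h \<in> carrier G" for h
      using 2[OF that] that assms(3) by (metis imageI m_closed inv_closed)
    show "\<alpha> y h \<in> \<alpha> x ` carrier G" if "h \<in> carrier G" for h
      using 1[OF that] that assms(3) by (metis imageI m_closed)
  qed
qed

end

section \<open>The adjoint group\<close>

context quandle
begin

lemma adj_words_iff [simp]:
  "[] \<in> adj_words Q" "x # w \<in> adj_words Q \<longleftrightarrow> snd x \<in> carrier Q \<and> w \<in> adj_words Q"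
  "u @ v \<in> adj_words Q \<longleftrightarrow> u \<in> adj_words Q \<and> v \<in> adj_words Q"
  by (auto simp: adj_words_def mem_Times_iff)

lemma adj_eq_words: "adj_eq Q u v \<Longrightarrow> u \<in> adj_words Q \<and> v \<in> adj_words Q"
  by (induction rule: adj_eq.induct) (auto simp: qop_closed)

lemma adj_class_eq_iff: "u \<in> adj_words Q \<Longrightarrow> adj_class Q u = adj_class Q v \<longleftrightarrow> adj_eq Q u v"
  unfolding adj_class_def by (metis (mono_tags) adj_eq.refl adj_eq.sym adj_eq.trans mem_Collect_eq subsetI subset_antisym)

lemma adj_class_eqI: "adj_eq Q u v \<Longrightarrow> adj_class Q u = adj_class Q v"
  by (simp add: adj_class_eq_iff adj_eq_words)

lemma adj_class_self: "u \<in> adj_words Q \<Longrightarrow> u \<in> adj_class Q u"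
  by (simp add: adj_class_def adj_eq.refl)

text \<open>
  Evaluates the maps out of the adjoint group that are given by \<open>the_elem\<close> on classes of words.
\<close>

lemma the_elem_adj_class:
  assumes "w \<in> adj_words Q" "\<And>u v. adj_eq Q u v \<Longrightarrow> f u = f v"
  shows "the_elem (f ` adj_class Q w) = f w"
proof -
  have "f v = f w" if "v \<in> adj_class Q w" for v
    using that assms(2)[of w v] by (simp add: adj_class_def)
  then have "f ` adj_class Q w = {f w}"
    using adj_class_self[OF assms(1)] by blast
  then show ?thesis by simp
qed

lemma Adj_carrier_iff: "g \<in> carrier (Adj Q) \<longleftrightarrow> (\<exists>w \<in> adj_words Q. g = adj_class Q w)"
  by (auto simp: Adj_def)

lemma adj_class_closed [simp]: "w \<in> adj_words Q \<Longrightarrow> adj_class Q w \<in> carrier (Adj Q)"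
  by (auto simp: Adj_carrier_iff)

lemma Adj_one: "\<one>\<^bsub>Adj Q\<^esub> = adj_class Q []"
  by (simp add: Adj_def)

lemma Adj_mult:
  assumes "u \<in> adj_words Q" "v \<in> adj_words Q"
  shows "adj_class Q u \<otimes>\<^bsub>Adj Q\<^esub> adj_class Q v = adj_class Q (u @ v)"
proof -
  have "adj_class Q (u' @ v') = adj_class Q (u @ v)"
    if "u' \<in> adj_class Q u" "v' \<in> adj_class Q v" for u' v'
    using that by (intro adj_class_eqI) (auto simp: adj_class_def intro: adj_eq.intros)
  then have "(\<Union>u' \<in> adj_class Q u. \<Union>v' \<in> adj_class Q v. adj_class Q (u' @ v'))
      = (\<Union>u' \<in> adj_class Q u. \<Union>v' \<in> adj_class Q v. adj_class Q (u @ v))"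
    by simp
  also have "\<dots> = adj_class Q (u @ v)"
    using adj_class_self[OF assms(1)] adj_class_self[OF assms(2)] by blast
  finally show ?thesis by (simp add: Adj_def)
qed

definition adj :: "'a \<Rightarrow> (bool \<times> 'a) list set" where
  "adj a = adj_class Q [(True, a)]"

text \<open>
  The inverse of a word reverses it and flips the exponent of every letter; it is built up letter by
  letter, moving a cancelling pair into the middle.
\<close>

lemma group_Adj: "group (Adj Q)"
proof (rule groupI)
  show "\<one>\<^bsub>Adj Q\<^esub> \<in> carrier (Adj Q)" by (simp add: Adj_one)
  fix g assume "g \<in> carrier (Adj Q)"
  then obtain w where w: "w \<in> adj_words Q" "g = adj_class Q w" by (auto simp: Adj_carrier_iff)
  then show "\<one>\<^bsub>Adj Q\<^esub> \<otimes>\<^bsub>Adj Q\<^esub> g = g" by (simp add: Adj_one Adj_mult)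
  have "\<exists>v \<in> adj_words Q. adj_eq Q (v @ w) []"
    using w(1)
  proof (induction w)
    case (Cons x w)
    then obtain v where v: "v \<in> adj_words Q" "adj_eq Q (v @ w) []" by auto
    obtain s a where x: "x = (s, a)" by (cases x)
    have a: "a \<in> carrier Q" and w: "w \<in> adj_words Q" using Cons.prems x by auto
    have "adj_eq Q ([(\<not> s, a)] @ [(s, a)]) []"
      using a adj_eq.cancel_left[OF a] adj_eq.cancel_right[OF a] by (cases s) auto
    then have "adj_eq Q (([(\<not> s, a)] @ [(s, a)]) @ w) ([] @ w)"
      using w by (intro adj_eq.cong adj_eq.refl)
    then have "adj_eq Q (v @ (([(\<not> s, a)] @ [(s, a)]) @ w)) (v @ ([] @ w))"
      by (rule adj_eq.cong[OF adj_eq.refl[OF v(1)]])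
    then have "adj_eq Q ((v @ [(\<not> s, a)]) @ (x # w)) []"
      using v x by (auto intro: adj_eq.trans)
    then show ?case using v a by (intro bexI[of _ "v @ [(\<not> s, a)]"]) auto
  qed (use adj_eq.refl[of "[]" Q] in \<open>auto intro!: bexI[of _ "[]"]\<close>)
  then show "\<exists>h \<in> carrier (Adj Q). h \<otimes>\<^bsub>Adj Q\<^esub> g = \<one>\<^bsub>Adj Q\<^esub>"
    using w by (metis Adj_mult Adj_one adj_class_closed adj_class_eqI)
next
  fix g h k assume "g \<in> carrier (Adj Q)" "h \<in> carrier (Adj Q)" "k \<in> carrier (Adj Q)"
  then show "g \<otimes>\<^bsub>Adj Q\<^esub> h \<otimes>\<^bsub>Adj Q\<^esub> k = g \<otimes>\<^bsub>Adj Q\<^esub> (h \<otimes>\<^bsub>Adj Q\<^esub> k)"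
    by (auto simp: Adj_carrier_iff Adj_mult)
qed (auto simp: Adj_carrier_iff Adj_mult)

sublocale Adj: group "Adj Q"
  by (rule group_Adj)

lemma adj_closed [simp]: "a \<in> carrier Q \<Longrightarrow> adj a \<in> carrier (Adj Q)"
  by (simp add: adj_def)

lemma adj_inv: "a \<in> carrier Q \<Longrightarrow> inv\<^bsub>Adj Q\<^esub> (adj a) = adj_class Q [(False, a)]"
  unfolding adj_def
  by (rule Adj.inv_equality) (simp_all add: Adj_mult Adj_one adj_class_eqI adj_eq.cancel_left)

lemma adj_qop:
  assumes "a \<in> carrier Q" "b \<in> carrier Q"
  shows "adj (a \<triangleright> b) = inv\<^bsub>Adj Q\<^esub> adj b \<otimes>\<^bsub>Adj Q\<^esub> adj a \<otimes>\<^bsub>Adj Q\<^esub> adj b"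
  using assms adj_class_eqI[OF adj_eq.relator[of a Q b]] by (simp add: adj_inv Adj_mult) (simp add: adj_def Adj_mult)

text \<open>
  Induction on a representing word, in a form that serves arguments about the group alone.
\<close>

lemma Adj_induct [consumes 1, case_names unit mult mult_inv]:
  assumes "g \<in> carrier (Adj Q)"
    and "P \<one>\<^bsub>Adj Q\<^esub>"
    and "\<And>g a. \<lbrakk>g \<in> carrier (Adj Q); a \<in> carrier Q; P g\<rbrakk> \<Longrightarrow> P (g \<otimes>\<^bsub>Adj Q\<^esub> adj a)"
    and "\<And>g a. \<lbrakk>g \<in> carrier (Adj Q); a \<in> carrier Q; P g\<rbrakk> \<Longrightarrow> P (g \<otimes>\<^bsub>Adj Q\<^esub> inv\<^bsub>Adj Q\<^esub> adj a)"
  shows "P g"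
proof -
  obtain w where w: "w \<in> adj_words Q" "g = adj_class Q w" using assms(1) by (auto simp: Adj_carrier_iff)
  have "P (adj_class Q w)" using w(1)
  proof (induction w rule: rev_induct)
    case Nil then show ?case using assms(2) by (simp add: Adj_one)
  next
    case (snoc x w)
    then obtain s a where "x = (s, a)" "a \<in> carrier Q" "w \<in> adj_words Q" "P (adj_class Q w)"
      by (cases x) auto
    then show ?case using assms(3,4)[of "adj_class Q w" a]
      by (cases s) (simp_all add: adj_inv Adj_mult, simp_all add: adj_def Adj_mult)
  qed
  then show ?thesis by (simp add: w)
qed

lemma foldl_words_closed:
  assumes "\<And>s x a. \<lbrakk>x \<in> X; a \<in> carrier Q\<rbrakk> \<Longrightarrow> f x (s, a) \<in> X"
  shows "\<lbrakk>w \<in> adj_words Q; x \<in> X\<rbrakk> \<Longrightarrow> foldl f x w \<in> X"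
  using assms by (induction w arbitrary: x) (auto simp: split_paired_all)

text \<open>
  Letters acting on a set give a well-defined action of \<open>Adj Q\<close> as soon as opposite letters undo each
  other and the relators hold. This is used for \<open>Q\<close> itself and for the total space of a covering.
\<close>

lemma foldl_adj_eq:
  assumes cl: "\<And>s x a. \<lbrakk>x \<in> X; a \<in> carrier Q\<rbrakk> \<Longrightarrow> f x (s, a) \<in> X"
    and inv: "\<And>s x a. \<lbrakk>x \<in> X; a \<in> carrier Q\<rbrakk> \<Longrightarrow> f (f x (s, a)) (\<not> s, a) = x"
    and rel: "\<And>x a b. \<lbrakk>x \<in> X; a \<in> carrier Q; b \<in> carrier Q\<rbrakk>
      \<Longrightarrow> f x (True, a \<triangleright> b) = f (f (f x (False, b)) (True, a)) (True, b)"
    and "adj_eq Q u v"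
  shows "x \<in> X \<Longrightarrow> foldl f x u = foldl f x v"
  using assms(4)
proof (induction arbitrary: x rule: adj_eq.induct)
  case (cong u u' v v')
  then show ?case using foldl_words_closed[of X f, OF cl] adj_eq_words[OF cong.hyps(1)] by auto
next
  case (cancel_right a)
  then show ?case using inv[of x a True] by simp
next
  case (cancel_left a)
  then show ?case using inv[of x a False] by simp
qed (auto simp: rel)

lemma right_action_foldl:
  assumes cl: "\<And>s x a. \<lbrakk>x \<in> X; a \<in> carrier Q\<rbrakk> \<Longrightarrow> f x (s, a) \<in> X"
    and inv: "\<And>s x a. \<lbrakk>x \<in> X; a \<in> carrier Q\<rbrakk> \<Longrightarrow> f (f x (s, a)) (\<not> s, a) = x"
    and rel: "\<And>x a b. \<lbrakk>x \<in> X; a \<in> carrier Q; b \<in> carrier Q\<rbrakk>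
      \<Longrightarrow> f x (True, a \<triangleright> b) = f (f (f x (False, b)) (True, a)) (True, b)"
    and \<alpha>: "\<And>x w. \<lbrakk>x \<in> X; w \<in> adj_words Q\<rbrakk> \<Longrightarrow> \<alpha> x (adj_class Q w) = foldl f x w"
  shows "right_action (Adj Q) X \<alpha>"
proof unfold_locales
  fix x g h assume *: "x \<in> X" "g \<in> carrier (Adj Q)"
  then show "\<alpha> x g \<in> X" by (auto simp: Adj_carrier_iff \<alpha> intro: foldl_words_closed[of X f, OF cl])
  show "h \<in> carrier (Adj Q) \<Longrightarrow> \<alpha> x (g \<otimes>\<^bsub>Adj Q\<^esub> h) = \<alpha> (\<alpha> x g) h"
    using * by (auto simp: Adj_carrier_iff \<alpha> Adj_mult foldl_words_closed[of X f, OF cl])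
qed (simp add: Adj_one \<alpha>)

lemma adj_act_class:
  assumes "x \<in> carrier Q" "w \<in> adj_words Q"
  shows "adj_act Q x (adj_class Q w) = foldl (\<lambda>y (s, a). if s then y \<triangleright> a else y \<triangleleft> a) x w"
  unfolding adj_act_def
proof (rule the_elem_adj_class)
  fix u v assume uv: "adj_eq Q u v"
  show "foldl (\<lambda>y (s, a). if s then y \<triangleright> a else y \<triangleleft> a) x u = foldl (\<lambda>y (s, a). if s then y \<triangleright> a else y \<triangleleft> a) x v"
    by (rule foldl_adj_eq[OF _ _ _ uv assms(1)])
      (auto simp: qop_closed qbar_closed qop_qbar qbar_qop qop_distrib)
qed (rule assms)

sublocale act: right_action "Adj Q" "carrier Q" "adj_act Q"
  by (rule right_action_foldl[OF _ _ _ adj_act_class])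
    (auto simp: qop_closed qbar_closed qop_qbar qbar_qop qop_distrib)

lemma adj_act_adj: "\<lbrakk>x \<in> carrier Q; a \<in> carrier Q\<rbrakk> \<Longrightarrow> adj_act Q x (adj a) = x \<triangleright> a"
  by (simp add: adj_act_class adj_def)

lemma adj_act_adj_inv: "\<lbrakk>x \<in> carrier Q; a \<in> carrier Q\<rbrakk> \<Longrightarrow> adj_act Q x (inv\<^bsub>Adj Q\<^esub> adj a) = x \<triangleleft> a"
  by (simp add: adj_act_class adj_inv)

text \<open>
  This relation makes \<open>adj\<close> equivariant from \<open>Q\<close> to \<open>Adj Q\<close> under conjugation. It is the defining
  relation when \<open>g\<close> is a generator, and it is inherited by products and inverses.
\<close>

lemma adj_act_conj:
  assumes "g \<in> carrier (Adj Q)" "a \<in> carrier Q"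
  shows "adj (adj_act Q a g) = inv\<^bsub>Adj Q\<^esub> g \<otimes>\<^bsub>Adj Q\<^esub> adj a \<otimes>\<^bsub>Adj Q\<^esub> g"
  using assms
proof (induction g rule: Adj_induct)
  case (mult g b)
  then show ?case
    by (simp add: act.act_mult act.act_closed adj_act_adj adj_qop Adj.inv_mult_group Adj.m_assoc)
next
  case (mult_inv g b)
  let ?a = "adj_act Q a g"
  have a: "?a \<in> carrier Q" using mult_inv by (simp add: act.act_closed)
  have "adj ?a = adj ((?a \<triangleleft> b) \<triangleright> b)"
    using a mult_inv by (simp add: qbar_qop)
  also have "\<dots> = inv\<^bsub>Adj Q\<^esub> adj b \<otimes>\<^bsub>Adj Q\<^esub> adj (?a \<triangleleft> b) \<otimes>\<^bsub>Adj Q\<^esub> adj b"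
    using a mult_inv by (simp add: adj_qop qbar_closed)
  finally have "adj ?a = \<dots>" .
  then have "adj (?a \<triangleleft> b) = adj b \<otimes>\<^bsub>Adj Q\<^esub> adj ?a \<otimes>\<^bsub>Adj Q\<^esub> inv\<^bsub>Adj Q\<^esub> adj b"
    using a mult_inv by (simp add: Adj.m_assoc Adj.cancel_inv qbar_closed)
  then show ?case
    using mult_inv a
    by (simp add: act.act_mult act.act_closed adj_act_adj_inv Adj.inv_mult_group Adj.m_assoc)
qed (simp add: act.act_one)

lemma adj_eps_class:
  assumes "w \<in> adj_words Q"
  shows "adj_eps (adj_class Q w) = (\<Sum>(s, a)\<leftarrow>w. if s then 1 else - 1)"
  unfolding adj_eps_def
proof (rule the_elem_adj_class[OF assms])
  show "(\<Sum>(s, a)\<leftarrow>u. if s then 1 else - 1 :: int) = (\<Sum>(s, a)\<leftarrow>v. if s then 1 else - 1)" if "adj_eq Q u v" for u v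
    using that by (induction rule: adj_eq.induct) auto
qed

lemma adj_eps_hom: "adj_eps \<in> hom (Adj Q) integer_group"
  by (rule homI) (auto simp: Adj_carrier_iff Adj_mult adj_eps_class)

sublocale eps: group_hom "Adj Q" integer_group adj_eps
  by (intro group_hom.intro group_hom_axioms.intro adj_eps_hom group_Adj group_integer_group)

lemma adj_eps_mult: "\<lbrakk>g \<in> carrier (Adj Q); h \<in> carrier (Adj Q)\<rbrakk>
    \<Longrightarrow> adj_eps (g \<otimes>\<^bsub>Adj Q\<^esub> h) = adj_eps g + adj_eps h"
  using eps.hom_mult by simp

lemma adj_eps_one: "adj_eps \<one>\<^bsub>Adj Q\<^esub> = 0"
  using eps.hom_one by simp

lemma adj_eps_adj: "a \<in> carrier Q \<Longrightarrow> adj_eps (adj a) = 1"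
  by (simp add: adj_def adj_eps_class)

lemma adj_eps_pow: "a \<in> carrier Q \<Longrightarrow> adj_eps (adj a [^]\<^bsub>Adj Q\<^esub> (n :: int)) = n"
  using eps.hom_int_pow[of "adj a" n] by (simp add: adj_eps_adj)

lemma carrier_fundamental_group:
  "g \<in> carrier (\<pi>\<^sub>1 Q x) \<longleftrightarrow> g \<in> carrier (Adj Q) \<and> adj_eps g = 0 \<and> adj_act Q x g = x"
  by (auto simp: fundamental_group_def kernel_def)

lemma fundamental_group_simps [simp]:
  "mult (\<pi>\<^sub>1 Q x) = mult (Adj Q)" "one (\<pi>\<^sub>1 Q x) = one (Adj Q)"
  by (simp_all add: fundamental_group_def)

lemma subgroup_fundamental_group:
  assumes "x \<in> carrier Q" shows "subgroup (carrier (\<pi>\<^sub>1 Q x)) (Adj Q)"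
proof -
  have "carrier (\<pi>\<^sub>1 Q x) = kernel (Adj Q) integer_group adj_eps \<inter> act.stabilizer x"
    by (auto simp: fundamental_group_def act.stabilizer_def kernel_def)
  then show ?thesis
    using Adj.subgroups_Inter_pair[OF eps.subgroup_kernel act.stabilizer_subgroup[OF assms]] by simp
qed

lemma group_fundamental_group: "x \<in> carrier Q \<Longrightarrow> group (\<pi>\<^sub>1 Q x)"
  using Adj.subgroup_imp_group[OF subgroup_fundamental_group] by (simp add: fundamental_group_def)

end

section \<open>Connected components as orbits of the adjoint group\<close>

context quandle
begin

definition translation :: "(bool \<times> 'a) list set \<Rightarrow> 'a \<Rightarrow> 'a" where
  "translation g = (\<lambda>x \<in> carrier Q. adj_act Q x g)"

text \<open>
  Acting by \<open>g\<close> is an automorphism because \<open>adj y \<cdot> g = g \<cdot> adj(y\<^sup>g)\<close>, the conjugation formula.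
\<close>

lemma adj_act_qop:
  assumes "x \<in> carrier Q" "y \<in> carrier Q" "g \<in> carrier (Adj Q)"
  shows "adj_act Q (x \<triangleright> y) g = adj_act Q x g \<triangleright> adj_act Q y g"
proof -
  have "adj_act Q x g \<triangleright> adj_act Q y g = adj_act Q x (g \<otimes>\<^bsub>Adj Q\<^esub> adj (adj_act Q y g))"
    using assms by (simp add: act.act_mult act.act_closed adj_act_adj)
  also have "\<dots> = adj_act Q x (adj y \<otimes>\<^bsub>Adj Q\<^esub> g)"
    using assms by (simp add: adj_act_conj Adj.m_assoc Adj.cancel_inv)
  finally show ?thesis
    using assms by (simp add: act.act_mult adj_act_adj)
qed

lemma carrier_QAut: "carrier (QAut Q) = qhom Q Q \<inter> Bij (carrier Q)"
  by (simp add: QAut_def)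

lemma QAut_mult: "\<lbrakk>f \<in> carrier (QAut Q); g \<in> carrier (QAut Q)\<rbrakk>
    \<Longrightarrow> f \<otimes>\<^bsub>QAut Q\<^esub> g = compose (carrier Q) f g"
  by (simp add: QAut_def BijGroup_def)

lemma translation_closed:
  assumes "g \<in> carrier (Adj Q)" shows "translation g \<in> carrier (QAut Q)"
proof -
  have "bij_betw (translation g) (carrier Q) (carrier Q)"
    using assms
    by (intro bij_betwI[where g = "translation (inv\<^bsub>Adj Q\<^esub> g)"])
      (auto simp: translation_def act.act_closed act.act_inv_left act.act_inv_right)
  then show ?thesis
    using assms by (auto simp: carrier_QAut Bij_def qhom_def translation_def act.act_closed adj_act_qop qop_closed)
qed

text \<open>
  The order is reversed since \<open>Adj Q\<close> acts from the right while composition of maps acts from the left.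
\<close>

lemma translation_mult:
  assumes "g \<in> carrier (Adj Q)" "h \<in> carrier (Adj Q)"
  shows "translation g \<otimes>\<^bsub>QAut Q\<^esub> translation h = translation (h \<otimes>\<^bsub>Adj Q\<^esub> g)"
  unfolding QAut_mult[OF translation_closed[OF assms(1)] translation_closed[OF assms(2)]]
  using assms by (auto simp: translation_def compose_def act.act_mult act.act_closed)

lemma translation_one: "\<one>\<^bsub>QAut Q\<^esub> = translation \<one>\<^bsub>Adj Q\<^esub>"
  by (auto simp: translation_def QAut_def BijGroup_def act.act_one)

lemma group_QAut: "group (QAut Q)"
proof (rule groupI)
  show "\<one>\<^bsub>QAut Q\<^esub> \<in> carrier (QAut Q)" by (simp add: translation_one translation_closed)
next
  have cl: "compose (carrier Q) f g \<in> carrier (QAut Q)"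
    if "f \<in> carrier (QAut Q)" "g \<in> carrier (QAut Q)" for f g
  proof -
    have "compose (carrier Q) f g \<in> qhom Q Q"
      using that by (auto simp: carrier_QAut qhom_def compose_def qop_closed PiE_iff)
    with that show ?thesis by (simp add: carrier_QAut compose_Bij)
  qed
  fix f g assume *: "f \<in> carrier (QAut Q)" "g \<in> carrier (QAut Q)"
  then show "f \<otimes>\<^bsub>QAut Q\<^esub> g \<in> carrier (QAut Q)"
    by (simp add: QAut_mult cl)
  fix h assume h: "h \<in> carrier (QAut Q)"
  show "f \<otimes>\<^bsub>QAut Q\<^esub> g \<otimes>\<^bsub>QAut Q\<^esub> h = f \<otimes>\<^bsub>QAut Q\<^esub> (g \<otimes>\<^bsub>QAut Q\<^esub> h)"
    using * h cl by (simp add: QAut_mult)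
      (rule compose_assoc[symmetric], auto simp: carrier_QAut Bij_imp_funcset)
next
  fix f assume f: "f \<in> carrier (QAut Q)"
  show "\<one>\<^bsub>QAut Q\<^esub> \<otimes>\<^bsub>QAut Q\<^esub> f = f"
    using f by (simp add: QAut_def BijGroup_def id_Bij Bij_imp_extensional Id_compose Bij_imp_funcset)
  let ?i = "\<lambda>x \<in> carrier Q. inv_into (carrier Q) f x"
  have fB: "f \<in> Bij (carrier Q)" and fh: "\<And>x y. \<lbrakk>x \<in> carrier Q; y \<in> carrier Q\<rbrakk> \<Longrightarrow> f (x \<triangleright> y) = f x \<triangleright> f y"
    using f by (auto simp: carrier_QAut qhom_def)
  have i: "?i \<in> Bij (carrier Q)" using fB by (rule restrict_inv_into_Bij)
  moreover have "?i \<in> qhom Q Q"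
    using fB Bij_inv_into_lemma[where g = "(\<triangleright>)" and h = f and S = "carrier Q"] fh
    by (auto simp: qhom_def Bij_inv_into_mem qop_closed)
  ultimately have "?i \<in> carrier (QAut Q)" by (simp add: carrier_QAut)
  moreover from this have "?i \<otimes>\<^bsub>QAut Q\<^esub> f = \<one>\<^bsub>QAut Q\<^esub>"
    using f fB Bij_compose_restrict_eq by (simp add: QAut_mult) (simp add: QAut_def BijGroup_def)
  ultimately show "\<exists>g \<in> carrier (QAut Q). g \<otimes>\<^bsub>QAut Q\<^esub> f = \<one>\<^bsub>QAut Q\<^esub>" by blast
qed

text \<open>
  The translations contain the generators of \<open>Inn Q\<close> and are closed under the group operations,
  since \<open>translation\<close> is an antihomomorphism; conversely each is a product of generators by induction
  in \<open>Adj Q\<close>.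
\<close>

lemma Inn_eq_translations: "Inn Q = translation ` carrier (Adj Q)"
proof -
  let ?gens = "{\<lambda>x \<in> carrier Q. x \<triangleright> a | a. a \<in> carrier Q}"
  interpret A: group "QAut Q" by (rule group_QAut)
  have gen: "(\<lambda>x \<in> carrier Q. x \<triangleright> a) = translation (adj a)" if "a \<in> carrier Q" for a
    using that by (auto simp: translation_def adj_act_adj)
  then have gens: "translation (adj a) \<in> ?gens" if "a \<in> carrier Q" for a
    using that by (metis (mono_tags, lifting) mem_Collect_eq)
  have inv_translation: "inv\<^bsub>QAut Q\<^esub> translation g = translation (inv\<^bsub>Adj Q\<^esub> g)" if "g \<in> carrier (Adj Q)" for g
    using that by (intro A.inv_equality) (simp_all add: translation_mult translation_one translation_closed)
  have "f \<in> translation ` carrier (Adj Q)" if "f \<in> generate (QAut Q) ?gens" for f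
    using that
  proof (induction rule: generate.induct)
    case one then show ?case by (auto simp: translation_one)
  next
    case (incl f) then show ?case by (auto simp: gen)
  next
    case (inv f)
    then obtain a where a: "a \<in> carrier Q" "f = translation (adj a)" by (auto simp: gen)
    then show ?case by (simp add: inv_translation)
  next
    case (eng f1 f2) then show ?case by (auto simp: translation_mult)
  qed
  moreover have "translation g \<in> generate (QAut Q) ?gens" if "g \<in> carrier (Adj Q)" for g
    using that
  proof (induction g rule: Adj_induct)
    case unit
    then show ?case using generate.one[of "QAut Q"] by (simp add: translation_one)
  next
    case (mult g a)
    have "translation (adj a) \<in> generate (QAut Q) ?gens"
      using mult by (intro generate.incl gens)
    from generate.eng[OF this mult.IH] show ?case using mult by (simp add: translation_mult)
  next
    case (mult_inv g a)
    have "inv\<^bsub>QAut Q\<^esub> translation (adj a) \<in> generate (QAut Q) ?gens"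
      using mult_inv by (intro generate.inv gens)
    from generate.eng[OF this mult_inv.IH] show ?case using mult_inv by (simp add: translation_mult inv_translation)
  qed
  ultimately show ?thesis unfolding Inn_def by blast
qed

lemma qcomponents_eq_orbits: "qcomponents Q = (\<lambda>x. adj_act Q x ` carrier (Adj Q)) ` carrier Q"
proof -
  have "{f x | f. f \<in> Inn Q} = adj_act Q x ` carrier (Adj Q)" if "x \<in> carrier Q" for x
  proof -
    have "{f x | f. f \<in> Inn Q} = (\<lambda>f. f x) ` Inn Q" by blast
    then show ?thesis
      using that by (simp add: Inn_eq_translations image_image translation_def cong: image_cong)
  qed
  then have "(\<lambda>x. {f x | f. f \<in> Inn Q}) ` carrier Q = (\<lambda>x. adj_act Q x ` carrier (Adj Q)) ` carrier Q"
    by (intro image_cong) auto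
  then show ?thesis by (simp add: qcomponents_def Setcompr_eq_image)
qed

text \<open>
  Equivariance need only be checked on the elements \<open>adj a\<close>: for their inverses it follows by
  cancelling \<open>adj a\<close>.
\<close>

lemma Adj_equivariantI:
  assumes X: "right_action (Adj Q) X \<alpha>" and Y: "right_action (Adj Q) Y \<beta>" and f: "f \<in> X \<rightarrow> Y"
    and gen: "\<And>x a. \<lbrakk>x \<in> X; a \<in> carrier Q\<rbrakk> \<Longrightarrow> f (\<alpha> x (adj a)) = \<beta> (f x) (adj a)"
    and g: "g \<in> carrier (Adj Q)" and x: "x \<in> X"
  shows "f (\<alpha> x g) = \<beta> (f x) g"
proof -
  interpret X: right_action "Adj Q" X \<alpha> by (rule X)
  interpret Y: right_action "Adj Q" Y \<beta> by (rule Y)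
  note f' = funcset_mem[OF f]
  show ?thesis
    using g x
  proof (induction g rule: Adj_induct)
    case unit
    then show ?case by (simp add: X.act_one Y.act_one f')
  next
    case (mult g a)
    then show ?case by (simp add: X.act_mult Y.act_mult gen X.act_closed f')
  next
    case (mult_inv g a)
    let ?z = "\<alpha> x (g \<otimes>\<^bsub>Adj Q\<^esub> inv\<^bsub>Adj Q\<^esub> adj a)"
    have z: "?z \<in> X" using mult_inv by (intro X.act_closed) auto
    have "\<alpha> ?z (adj a) = \<alpha> x g" using mult_inv by (simp add: X.act_mult X.act_closed X.act_inv_left)
    then have "\<beta> (f ?z) (adj a) = \<beta> (f x) g" using gen[OF z mult_inv(2)] mult_inv by simp
    then have "\<beta> (\<beta> (f ?z) (adj a)) (inv\<^bsub>Adj Q\<^esub> adj a) = \<beta> (\<beta> (f x) g) (inv\<^bsub>Adj Q\<^esub> adj a)" by simp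
    then show ?case using mult_inv z by (simp add: Y.act_inv_right Y.act_mult f')
  qed
qed

end

section \<open>Monodromy\<close>

locale quandle_covering =
  fixes Q :: "('a, 'b) quandle_scheme" and P :: "('u, 'a, 'x) covering_scheme"
  assumes is_covering: "is_covering Q P"

sublocale quandle_covering \<subseteq> Q: quandle Q
  using is_covering by (simp add: is_covering_def)

sublocale quandle_covering \<subseteq> T: quandle "total P"
  using is_covering by (simp add: is_covering_def)

context quandle_covering
begin

lemma proj_qhom: "proj P \<in> qhom (total P) Q"
  using is_covering by (simp add: is_covering_def)

lemma proj_closed [simp]: "x \<in> carrier (total P) \<Longrightarrow> proj P x \<in> carrier Q"
  using proj_qhom by (auto simp: qhom_def)

lemma proj_qop: "\<lbrakk>x \<in> carrier (total P); y \<in> carrier (total P)\<rbrakk>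
    \<Longrightarrow> proj P (x \<triangleright>\<^bsub>total P\<^esub> y) = proj P x \<triangleright>\<^bsub>Q\<^esub> proj P y"
  using proj_qhom by (simp add: qhom_def)

lemma proj_surj: "a \<in> carrier Q \<Longrightarrow> \<exists>x \<in> carrier (total P). proj P x = a"
  using is_covering unfolding is_covering_def by (metis imageE)

lemma qop_proj_cong:
  "\<lbrakk>x \<in> carrier (total P); y \<in> carrier (total P); z \<in> carrier (total P); proj P y = proj P z\<rbrakk>
    \<Longrightarrow> x \<triangleright>\<^bsub>total P\<^esub> y = x \<triangleright>\<^bsub>total P\<^esub> z"
  using is_covering unfolding is_covering_def by blast

text \<open>
  Both \<open>x \<triangleleft> y\<close> and \<open>x \<triangleleft> z\<close> are the preimage of \<open>x\<close> under right translation by \<open>y\<close>, which is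
  right translation by \<open>z\<close>.
\<close>

lemma qbar_proj_cong:
  assumes "x \<in> carrier (total P)" "y \<in> carrier (total P)" "z \<in> carrier (total P)" "proj P y = proj P z"
  shows "x \<triangleleft>\<^bsub>total P\<^esub> y = x \<triangleleft>\<^bsub>total P\<^esub> z"
  using assms qop_proj_cong[of "x \<triangleleft>\<^bsub>total P\<^esub> y" y z]
  by (metis T.qbar_closed T.qbar_qop T.qop_qbar)

definition lift_point :: "'a \<Rightarrow> 'u" where
  "lift_point a = (SOME y. y \<in> carrier (total P) \<and> proj P y = a)"

lemma lift_point: "a \<in> carrier Q \<Longrightarrow> lift_point a \<in> carrier (total P) \<and> proj P (lift_point a) = a"
  unfolding lift_point_def by (rule someI_ex) (use proj_surj in blast)

text \<open>
  The action of the generators of \<open>Adj Q\<close> on the total space through an arbitrary lift; the covering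
  property makes it independent of the lift, which \<open>letter_act_proj\<close> records.
\<close>

definition letter_act :: "'u \<Rightarrow> bool \<times> 'a \<Rightarrow> 'u" where
  "letter_act x = (\<lambda>(s, a). if s then x \<triangleright>\<^bsub>total P\<^esub> lift_point a else x \<triangleleft>\<^bsub>total P\<^esub> lift_point a)"

lemma letter_act_proj:
  assumes "x \<in> carrier (total P)" "y \<in> carrier (total P)"
  shows "letter_act x (s, proj P y) = (if s then x \<triangleright>\<^bsub>total P\<^esub> y else x \<triangleleft>\<^bsub>total P\<^esub> y)"
  using assms lift_point[of "proj P y"]
  by (simp add: letter_act_def qop_proj_cong[of x "lift_point (proj P y)" y]
      qbar_proj_cong[of x "lift_point (proj P y)" y])

lemma letter_act_closed: "\<lbrakk>x \<in> carrier (total P); a \<in> carrier Q\<rbrakk> \<Longrightarrow> letter_act x (s, a) \<in> carrier (total P)"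
  by (simp add: letter_act_def lift_point T.qop_closed T.qbar_closed)

lemma letter_act_inv: "\<lbrakk>x \<in> carrier (total P); a \<in> carrier Q\<rbrakk> \<Longrightarrow> letter_act (letter_act x (s, a)) (\<not> s, a) = x"
  by (simp add: letter_act_def lift_point T.qop_qbar T.qbar_qop)

text \<open>
  The element \<open>a * b\<close> lifts to the product of lifts of \<open>a\<close> and \<open>b\<close>, so the relator reduces to
  self-distributivity upstairs.
\<close>

lemma letter_act_relator:
  assumes "x \<in> carrier (total P)" "a \<in> carrier Q" "b \<in> carrier Q"
  shows "letter_act x (True, a \<triangleright>\<^bsub>Q\<^esub> b)
    = letter_act (letter_act (letter_act x (False, b)) (True, a)) (True, b)"
proof -
  let ?a = "lift_point a" and ?b = "lift_point b"
  note l = lift_point[OF assms(2)] lift_point[OF assms(3)]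
  have "letter_act x (True, a \<triangleright>\<^bsub>Q\<^esub> b) = x \<triangleright>\<^bsub>total P\<^esub> (?a \<triangleright>\<^bsub>total P\<^esub> ?b)"
    using letter_act_proj[of x "?a \<triangleright>\<^bsub>total P\<^esub> ?b" True] l assms by (simp add: T.qop_closed proj_qop)
  also have "\<dots> = ((x \<triangleleft>\<^bsub>total P\<^esub> ?b) \<triangleright>\<^bsub>total P\<^esub> ?a) \<triangleright>\<^bsub>total P\<^esub> ?b"
    using l assms T.qop_distrib[of "x \<triangleleft>\<^bsub>total P\<^esub> ?b" ?a ?b] by (simp add: T.qbar_closed T.qbar_qop)
  finally show ?thesis by (simp add: letter_act_def)
qed

abbreviation proj_word :: "(bool \<times> 'u) list \<Rightarrow> (bool \<times> 'a) list" where
  "proj_word \<equiv> map (map_prod id (proj P))"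

lemma proj_word_closed: "w \<in> adj_words (total P) \<Longrightarrow> proj_word w \<in> adj_words Q"
  by (induction w) auto

lemma proj_word_surj: "v \<in> adj_words Q \<Longrightarrow> \<exists>w \<in> adj_words (total P). proj_word w = v"
proof (induction v)
  case (Cons x v)
  then obtain w y where "w \<in> adj_words (total P)" "proj_word w = v" "y \<in> carrier (total P)" "proj P y = snd x"
    using proj_surj by fastforce
  then show ?case by (intro bexI[of _ "(fst x, y) # w"]) auto
qed auto

lemma adj_map_class:
  assumes "w \<in> adj_words (total P)"
  shows "adj_map (total P) Q (proj P) (adj_class (total P) w) = adj_class Q (proj_word w)"
  unfolding adj_map_def
proof (rule T.the_elem_adj_class[OF assms])
  fix u v assume "adj_eq (total P) u v"
  then have "adj_eq Q (proj_word u) (proj_word v)"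
  proof (induction rule: adj_eq.induct)
    case (refl u)
    then show ?case by (intro adj_eq.refl proj_word_closed)
  next
    case (relator a b)
    then show ?case using adj_eq.relator[of "proj P a" Q "proj P b"] by (simp add: proj_qop)
  qed (auto intro: adj_eq.intros)
  then show "adj_class Q (proj_word u) = adj_class Q (proj_word v)" by (rule Q.adj_class_eqI)
qed

lemma adj_map_closed:
  "h \<in> carrier (Adj (total P)) \<Longrightarrow> adj_map (total P) Q (proj P) h \<in> carrier (Adj Q)"
  by (auto simp: T.Adj_carrier_iff adj_map_class proj_word_closed)

lemma adj_map_surj:
  "g \<in> carrier (Adj Q) \<Longrightarrow> \<exists>h \<in> carrier (Adj (total P)). adj_map (total P) Q (proj P) h = g"
  by (metis proj_word_surj T.adj_class_closed Q.Adj_carrier_iff adj_map_class)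

lemma adj_eps_adj_map:
  assumes "h \<in> carrier (Adj (total P))"
  shows "adj_eps (adj_map (total P) Q (proj P) h) = adj_eps h"
proof -
  obtain w where w: "w \<in> adj_words (total P)" "h = adj_class (total P) w"
    using assms by (auto simp: T.Adj_carrier_iff)
  have "(\<Sum>(s, a)\<leftarrow>proj_word w. if s then 1 else - 1 :: int) = (\<Sum>(s, a)\<leftarrow>w. if s then 1 else - 1)"
    by (induction w) (auto simp: map_prod_def)
  then show ?thesis
    using w by (simp add: adj_map_class Q.adj_eps_class T.adj_eps_class proj_word_closed)
qed

lemma adj_act_total_class:
  assumes "x \<in> carrier (total P)" "w \<in> adj_words (total P)"
  shows "adj_act (total P) x (adj_class (total P) w) = foldl letter_act x (proj_word w)"
  unfolding T.adj_act_class[OF assms] using assms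
proof (induction w arbitrary: x)
  case (Cons y w)
  then show ?case
    by (cases y) (auto simp: letter_act_proj T.qop_closed T.qbar_closed)
qed simp

text \<open>
  The lift in the definition of monodromy exists because words lift letter by letter. Two lifts of the
  same group element project to equivalent words, which act in the same way.
\<close>

lemma monodromy_class:
  assumes x: "x \<in> carrier (total P)" and v: "v \<in> adj_words Q"
  shows "monodromy Q P x (adj_class Q v) = foldl letter_act x v"
  unfolding monodromy_def
proof (rule the_equality)
  obtain w where w: "w \<in> adj_words (total P)" "proj_word w = v" using proj_word_surj[OF v] by blast
  then show "\<exists>h \<in> carrier (Adj (total P)). adj_map (total P) Q (proj P) h = adj_class Q v
      \<and> foldl letter_act x v = adj_act (total P) x h"
    using x by (intro bexI[of _ "adj_class (total P) w"]) (simp_all add: adj_map_class adj_act_total_class)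
next
  fix y assume "\<exists>h \<in> carrier (Adj (total P)). adj_map (total P) Q (proj P) h = adj_class Q v
      \<and> y = adj_act (total P) x h"
  then obtain w where w: "w \<in> adj_words (total P)" "adj_class Q (proj_word w) = adj_class Q v"
      "y = foldl letter_act x (proj_word w)"
    using x by (auto simp: T.Adj_carrier_iff adj_map_class adj_act_total_class)
  then have "adj_eq Q (proj_word w) v" by (simp add: Q.adj_class_eq_iff proj_word_closed)
  from Q.foldl_adj_eq[OF letter_act_closed letter_act_inv letter_act_relator this x]
  show "y = foldl letter_act x v" by (simp add: w)
qed

sublocale mon: right_action "Adj Q" "carrier (total P)" "monodromy Q P"
  by (rule Q.right_action_foldl[OF letter_act_closed letter_act_inv letter_act_relator monodromy_class])

lemma monodromy_adj:
  "\<lbrakk>x \<in> carrier (total P); y \<in> carrier (total P)\<rbrakk> \<Longrightarrow> monodromy Q P x (Q.adj (proj P y)) = x \<triangleright>\<^bsub>total P\<^esub> y"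
  by (simp add: Q.adj_def monodromy_class letter_act_proj)

text \<open>
  The adjoint group of the total space acts through the adjoint group of the base.
\<close>

lemma adj_act_total_eq_monodromy:
  assumes "x \<in> carrier (total P)" "h \<in> carrier (Adj (total P))"
  shows "adj_act (total P) x h = monodromy Q P x (adj_map (total P) Q (proj P) h)"
  using assms
  by (auto simp: T.Adj_carrier_iff adj_map_class adj_act_total_class monodromy_class proj_word_closed)

lemma proj_monodromy:
  assumes "x \<in> carrier (total P)" "g \<in> carrier (Adj Q)"
  shows "proj P (monodromy Q P x g) = adj_act Q (proj P x) g"
proof (rule Q.Adj_equivariantI[OF mon.right_action_axioms Q.act.right_action_axioms _ _ assms(2,1)])
  fix x a assume "x \<in> carrier (total P)" "a \<in> carrier Q"
  moreover from this obtain y where "y \<in> carrier (total P)" "proj P y = a" using proj_surj by blast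
  ultimately show "proj P (monodromy Q P x (Q.adj a)) = adj_act Q (proj P x) (Q.adj a)"
    using monodromy_adj[of x y] by (auto simp: proj_qop Q.adj_act_adj)
qed auto

lemma monodromy_adj_self: "x \<in> carrier (total P) \<Longrightarrow> monodromy Q P x (Q.adj (proj P x)) = x"
  by (simp add: monodromy_adj T.qop_idem)

lemma orbit_total: "x \<in> carrier (total P)
    \<Longrightarrow> adj_act (total P) x ` carrier (Adj (total P)) = monodromy Q P x ` carrier (Adj Q)"
  using adj_map_surj adj_map_closed by (force simp: adj_act_total_eq_monodromy image_iff)

end

text \<open>
  On generators this is the homomorphism property, as \<open>x\<cdot>adj(p y) = x * y\<close>.
\<close>

lemma covering_hom_monodromy:
  assumes "is_covering Q P" "is_covering Q P'" "\<phi> \<in> covering_hom P P'"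
    and "x \<in> carrier (total P)" "g \<in> carrier (Adj Q)"
  shows "\<phi> (monodromy Q P x g) = monodromy Q P' (\<phi> x) g"
proof -
  interpret P: quandle_covering Q P by unfold_locales fact
  interpret P': quandle_covering Q P' by unfold_locales fact
  have cl: "\<phi> x \<in> carrier (total P')" "proj P' (\<phi> x) = proj P x" if "x \<in> carrier (total P)" for x
    using that assms(3) by (auto simp: covering_hom_def qhom_def)
  show ?thesis
  proof (rule P.Q.Adj_equivariantI[OF P.mon.right_action_axioms P'.mon.right_action_axioms _ _ assms(5,4)])
    fix x a assume x: "x \<in> carrier (total P)" and "a \<in> carrier Q"
    moreover from this obtain y where y: "y \<in> carrier (total P)" "proj P y = a" using P.proj_surj by blast
    moreover have "\<phi> (x \<triangleright>\<^bsub>total P\<^esub> y) = \<phi> x \<triangleright>\<^bsub>total P'\<^esub> \<phi> y"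
      using assms(3) x y by (auto simp: covering_hom_def qhom_def)
    ultimately show "\<phi> (monodromy Q P x (P.Q.adj a)) = monodromy Q P' (\<phi> x) (P.Q.adj a)"
      using P.monodromy_adj[of x y] P'.monodromy_adj[of "\<phi> x" "\<phi> y"] cl by auto
  qed (use cl in auto)
qed

text \<open>
  The inverse of passing to the monodromy action. Idempotence of the quandle \<open>x * y = x\<cdot>adj(p y)\<close> is
  the hypothesis \<open>self\<close>, and self-distributivity is the conjugation formula for \<open>adj\<close>.
\<close>

lemma (in quandle) covering_of_action:
  fixes X :: "'u set"
  assumes "right_action (Adj Q) X \<alpha>" and p: "p \<in> X \<rightarrow> carrier Q" "p ` X = carrier Q"
    and equiv: "\<And>x g. \<lbrakk>x \<in> X; g \<in> carrier (Adj Q)\<rbrakk> \<Longrightarrow> p (\<alpha> x g) = adj_act Q (p x) g"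
    and self: "\<And>x. x \<in> X \<Longrightarrow> \<alpha> x (adj (p x)) = x"
  obtains P :: "('u, 'a) covering" where "is_covering Q P" "carrier (total P) = X"
    "\<And>x. x \<in> X \<Longrightarrow> proj P x = p x"
    "\<And>x g. \<lbrakk>x \<in> X; g \<in> carrier (Adj Q)\<rbrakk> \<Longrightarrow> monodromy Q P x g = \<alpha> x g"
proof -
  interpret X: right_action "Adj Q" X \<alpha> by fact
  define P :: "('u, 'a) covering" where
    "P = \<lparr>total = \<lparr>carrier = X, qop = (\<lambda>x y. \<alpha> x (adj (p y))), qbar = (\<lambda>x y. \<alpha> x (inv\<^bsub>Adj Q\<^esub> adj (p y)))\<rparr>,
      proj = restrict p X\<rparr>"
  have P: "carrier (total P) = X" "\<And>x y. x \<triangleright>\<^bsub>total P\<^esub> y = \<alpha> x (adj (p y))"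
      "\<And>x y. x \<triangleleft>\<^bsub>total P\<^esub> y = \<alpha> x (inv\<^bsub>Adj Q\<^esub> adj (p y))" "proj P = restrict p X"
    by (simp_all add: P_def)
  have pX [simp]: "x \<in> X \<Longrightarrow> p x \<in> carrier Q" for x using p by auto
  have "quandle (total P)"
  proof
    fix x y z assume *: "x \<in> carrier (total P)" "y \<in> carrier (total P)" "z \<in> carrier (total P)"
    then have "adj (p z) \<otimes>\<^bsub>Adj Q\<^esub> adj (p (\<alpha> y (adj (p z)))) = adj (p y) \<otimes>\<^bsub>Adj Q\<^esub> adj (p z)"
      by (simp add: P equiv adj_act_conj Adj.m_assoc Adj.cancel_inv)
    then show "x \<triangleright>\<^bsub>total P\<^esub> y \<triangleright>\<^bsub>total P\<^esub> z = x \<triangleright>\<^bsub>total P\<^esub> z \<triangleright>\<^bsub>total P\<^esub> (y \<triangleright>\<^bsub>total P\<^esub> z)"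
      using * by (simp add: P X.act_closed flip: X.act_mult)
  qed (simp_all add: P X.act_closed self X.act_inv_left X.act_inv_right)
  then have cov: "is_covering Q P"
    using p quandle_axioms
    by (auto simp: is_covering_def qhom_def P X.act_closed equiv adj_act_adj)
  interpret P: quandle_covering Q P by unfold_locales (rule cov)
  have "monodromy Q P x g = \<alpha> x g" if "x \<in> X" "g \<in> carrier (Adj Q)" for x g
  proof (rule Adj_equivariantI[where f = "\<lambda>x. x", OF X.right_action_axioms P.mon.right_action_axioms _ _ that(2,1), symmetric])
    fix x a assume x: "x \<in> X" "a \<in> carrier Q"
    with p(2) obtain y where "y \<in> X" "p y = a" by (metis imageE)
    then show "\<alpha> x (adj a) = monodromy Q P x (adj a)" using P.monodromy_adj[of x y] x by (simp add: P)
  qed (simp add: P)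
  with that[of P] cov P show ?thesis by simp
qed

section \<open>Stabilisers in the adjoint group\<close>

context quandle
begin

lemma adj_pow_stabilizes:
  assumes "right_action (Adj Q) X \<alpha>" "x \<in> X" "a \<in> carrier Q" "\<alpha> x (adj a) = x"
  shows "\<alpha> x (adj a [^]\<^bsub>Adj Q\<^esub> (n :: int)) = x"
proof -
  interpret X: right_action "Adj Q" X \<alpha> by fact
  have "adj a \<in> X.stabilizer x" using assms by (simp add: X.stabilizer_def)
  from Adj.subgroup_int_pow_closed[OF X.stabilizer_subgroup[OF assms(2)] this]
  show ?thesis by (simp add: X.stabilizer_def)
qed

text \<open>
  On the stabiliser of \<open>a\<close> this is the projection to \<open>\<pi>\<^sub>1 Q a\<close> along the central cyclic subgroup
  generated by \<open>adj a\<close>.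
\<close>

definition loop_part :: "'a \<Rightarrow> (bool \<times> 'a) list set \<Rightarrow> (bool \<times> 'a) list set" where
  "loop_part a s = adj a [^]\<^bsub>Adj Q\<^esub> (- adj_eps s) \<otimes>\<^bsub>Adj Q\<^esub> s"

text \<open>
  Points that are fixed by \<open>adj a\<close> cannot distinguish \<open>s\<close> from its loop part. This is how an action of
  \<open>\<pi>\<^sub>1\<close> controls the action of the full stabiliser on a fibre.
\<close>

lemma loop_part_act:
  assumes "right_action (Adj Q) X \<alpha>" "x \<in> X" "a \<in> carrier Q" "\<alpha> x (adj a) = x" "s \<in> carrier (Adj Q)"
  shows "\<alpha> x (loop_part a s) = \<alpha> x s"
proof -
  interpret X: right_action "Adj Q" X \<alpha> by fact
  show ?thesis using assms by (simp add: loop_part_def X.act_mult adj_pow_stabilizes[OF assms(1-4)])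
qed

lemma loop_part_closed [simp]:
  "\<lbrakk>a \<in> carrier Q; s \<in> carrier (Adj Q)\<rbrakk> \<Longrightarrow> loop_part a s \<in> carrier (Adj Q)"
  by (simp add: loop_part_def)

lemma adj_act_loop_part:
  "\<lbrakk>a \<in> carrier Q; s \<in> carrier (Adj Q)\<rbrakk> \<Longrightarrow> adj_act Q a (loop_part a s) = adj_act Q a s"
  by (rule loop_part_act[OF act.right_action_axioms]) (simp_all add: adj_act_adj qop_idem)

lemma adj_eps_loop_part: "\<lbrakk>a \<in> carrier Q; s \<in> carrier (Adj Q)\<rbrakk> \<Longrightarrow> adj_eps (loop_part a s) = 0"
  by (simp add: loop_part_def adj_eps_mult adj_eps_pow)

lemma loop_part_fundamental_group:
  assumes "a \<in> carrier Q" "s \<in> act.stabilizer a"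
  shows "loop_part a s \<in> carrier (\<pi>\<^sub>1 Q a)"
  using assms by (simp add: act.stabilizer_def carrier_fundamental_group adj_act_loop_part adj_eps_loop_part)

text \<open>
  The conjugation formula gives \<open>s\<inverse> adj(a) s = adj(a\<^sup>s) = adj(a)\<close>, so \<open>adj a\<close> lies in the centraliser
  of \<open>s\<close>; hence so do its powers.
\<close>

lemma adj_pow_commutes:
  assumes a: "a \<in> carrier Q" and s: "s \<in> act.stabilizer a"
  shows "adj a [^]\<^bsub>Adj Q\<^esub> (n :: int) \<otimes>\<^bsub>Adj Q\<^esub> s = s \<otimes>\<^bsub>Adj Q\<^esub> adj a [^]\<^bsub>Adj Q\<^esub> n"
proof -
  let ?C = "{g \<in> carrier (Adj Q). g \<otimes>\<^bsub>Adj Q\<^esub> s = s \<otimes>\<^bsub>Adj Q\<^esub> g}"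
  have s': "s \<in> carrier (Adj Q)" "adj_act Q a s = a" using s by (auto simp: act.stabilizer_def)
  have "subgroup ?C (Adj Q)"
  proof (rule Adj.subgroupI)
    show "?C \<noteq> {}" using s' by (auto intro!: exI[of _ "\<one>\<^bsub>Adj Q\<^esub>"])
  next
    fix g assume "g \<in> ?C"
    then have g: "g \<in> carrier (Adj Q)" "g \<otimes>\<^bsub>Adj Q\<^esub> s = s \<otimes>\<^bsub>Adj Q\<^esub> g" by auto
    have "inv\<^bsub>Adj Q\<^esub> g \<otimes>\<^bsub>Adj Q\<^esub> s = inv\<^bsub>Adj Q\<^esub> g \<otimes>\<^bsub>Adj Q\<^esub> (s \<otimes>\<^bsub>Adj Q\<^esub> g) \<otimes>\<^bsub>Adj Q\<^esub> inv\<^bsub>Adj Q\<^esub> g"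
      using s' g(1) by (simp add: Adj.m_assoc)
    also have "\<dots> = inv\<^bsub>Adj Q\<^esub> g \<otimes>\<^bsub>Adj Q\<^esub> (g \<otimes>\<^bsub>Adj Q\<^esub> s) \<otimes>\<^bsub>Adj Q\<^esub> inv\<^bsub>Adj Q\<^esub> g"
      using g by simp
    also have "\<dots> = s \<otimes>\<^bsub>Adj Q\<^esub> inv\<^bsub>Adj Q\<^esub> g"
      using g(1) s' by (simp add: Adj.m_assoc Adj.cancel_inv)
    finally show "inv\<^bsub>Adj Q\<^esub> g \<in> ?C" using g by simp
  next
    fix g h assume "g \<in> ?C" "h \<in> ?C"
    then have gh: "g \<in> carrier (Adj Q)" "h \<in> carrier (Adj Q)"
      "g \<otimes>\<^bsub>Adj Q\<^esub> s = s \<otimes>\<^bsub>Adj Q\<^esub> g" "h \<otimes>\<^bsub>Adj Q\<^esub> s = s \<otimes>\<^bsub>Adj Q\<^esub> h" by auto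
    have "g \<otimes>\<^bsub>Adj Q\<^esub> h \<otimes>\<^bsub>Adj Q\<^esub> s = g \<otimes>\<^bsub>Adj Q\<^esub> s \<otimes>\<^bsub>Adj Q\<^esub> h"
      using s' gh(1,2,4) by (simp add: Adj.m_assoc)
    also have "\<dots> = s \<otimes>\<^bsub>Adj Q\<^esub> (g \<otimes>\<^bsub>Adj Q\<^esub> h)"
      using gh s' by (simp flip: Adj.m_assoc)
    finally show "g \<otimes>\<^bsub>Adj Q\<^esub> h \<in> ?C" using gh by simp
  qed auto
  moreover have "adj a \<in> ?C"
  proof -
    have "inv\<^bsub>Adj Q\<^esub> s \<otimes>\<^bsub>Adj Q\<^esub> adj a \<otimes>\<^bsub>Adj Q\<^esub> s = adj a"
      using adj_act_conj[OF s'(1) a] s' by simp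
    then have "s \<otimes>\<^bsub>Adj Q\<^esub> (inv\<^bsub>Adj Q\<^esub> s \<otimes>\<^bsub>Adj Q\<^esub> adj a \<otimes>\<^bsub>Adj Q\<^esub> s) = s \<otimes>\<^bsub>Adj Q\<^esub> adj a" by simp
    then show ?thesis using a s' by (simp add: Adj.m_assoc Adj.cancel_inv)
  qed
  ultimately show ?thesis using Adj.subgroup_int_pow_closed[of ?C "adj a" n] by simp
qed

lemma loop_part_mult:
  assumes a: "a \<in> carrier Q" and st: "s \<in> act.stabilizer a" "t \<in> act.stabilizer a"
  shows "loop_part a (s \<otimes>\<^bsub>Adj Q\<^esub> t) = loop_part a s \<otimes>\<^bsub>Adj Q\<^esub> loop_part a t"
proof -
  have [simp]: "s \<in> carrier (Adj Q)" "t \<in> carrier (Adj Q)" using st by (auto simp: act.stabilizer_def)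
  let ?p = "\<lambda>n :: int. adj a [^]\<^bsub>Adj Q\<^esub> n"
  have "?p (- adj_eps (s \<otimes>\<^bsub>Adj Q\<^esub> t)) = ?p (- adj_eps s) \<otimes>\<^bsub>Adj Q\<^esub> ?p (- adj_eps t)"
    using a by (simp add: adj_eps_mult flip: Adj.int_pow_mult)
  then have "loop_part a (s \<otimes>\<^bsub>Adj Q\<^esub> t)
      = ?p (- adj_eps s) \<otimes>\<^bsub>Adj Q\<^esub> (?p (- adj_eps t) \<otimes>\<^bsub>Adj Q\<^esub> s) \<otimes>\<^bsub>Adj Q\<^esub> t"
    using a by (simp add: loop_part_def Adj.m_assoc)
  then show ?thesis
    using a by (simp add: adj_pow_commutes[OF a st(1), of "- adj_eps t"] loop_part_def Adj.m_assoc)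
qed

lemma loop_part_loop: "\<lbrakk>a \<in> carrier Q; g \<in> carrier (\<pi>\<^sub>1 Q a)\<rbrakk> \<Longrightarrow> loop_part a g = g"
  by (simp add: loop_part_def carrier_fundamental_group)

lemma loop_part_adj: "a \<in> carrier Q \<Longrightarrow> loop_part a (adj a) = \<one>\<^bsub>Adj Q\<^esub>"
  by (simp add: loop_part_def adj_eps_adj Adj.int_pow_neg)

end

section \<open>Well-pointed quandles\<close>

locale well_pointed_quandle =
  fixes Q :: "('a, 'b) quandle_scheme" and I :: "'i set" and Qc :: "'i \<Rightarrow> 'a set" and q :: "'i \<Rightarrow> 'a"
  assumes well_pointed: "well_pointed Q I Qc q"

sublocale well_pointed_quandle \<subseteq> quandle Q
  using well_pointed by (simp add: well_pointed_def)

context well_pointed_quandle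
begin

lemma Qc_component: "i \<in> I \<Longrightarrow> Qc i \<in> qcomponents Q"
  using well_pointed by (auto simp: well_pointed_def bij_betw_def)

lemma q_in_Qc: "i \<in> I \<Longrightarrow> q i \<in> Qc i"
  using well_pointed by (simp add: well_pointed_def)

lemma Qc_eq_orbit_of:
  assumes "i \<in> I" "a \<in> Qc i"
  shows "a \<in> carrier Q" "Qc i = adj_act Q a ` carrier (Adj Q)"
proof -
  obtain x where x: "x \<in> carrier Q" "Qc i = adj_act Q x ` carrier (Adj Q)"
    using Qc_component[OF assms(1)] by (auto simp: qcomponents_eq_orbits)
  then obtain g where g: "g \<in> carrier (Adj Q)" "a = adj_act Q x g" using assms by auto
  then show a: "a \<in> carrier Q" using x by (simp add: act.act_closed)
  show "Qc i = adj_act Q a ` carrier (Adj Q)"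
    using act.orbit_eqI[OF x(1) a g(1)] g(2) x(2) by simp
qed

lemma q_closed [simp]: "i \<in> I \<Longrightarrow> q i \<in> carrier Q"
  using Qc_eq_orbit_of q_in_Qc by blast

lemma Qc_eq: "i \<in> I \<Longrightarrow> Qc i = adj_act Q (q i) ` carrier (Adj Q)"
  using Qc_eq_orbit_of q_in_Qc by blast

lemma Qc_unique:
  assumes "i \<in> I" "j \<in> I" "a \<in> Qc i" "a \<in> Qc j" shows "i = j"
proof -
  have "Qc i = Qc j" using assms Qc_eq_orbit_of(2) by metis
  then show ?thesis using well_pointed assms by (auto simp: well_pointed_def bij_betw_def dest: inj_onD)
qed

lemma Qc_cover:
  assumes "a \<in> carrier Q" shows "\<exists>i \<in> I. a \<in> Qc i"
proof -
  have "adj_act Q a ` carrier (Adj Q) \<in> Qc ` I"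
    using assms well_pointed by (auto simp: well_pointed_def bij_betw_def qcomponents_eq_orbits)
  moreover have "a \<in> adj_act Q a ` carrier (Adj Q)"
    using assms act.act_one[of a] by (metis Adj.one_closed imageI)
  ultimately show ?thesis by auto
qed

definition idx :: "'a \<Rightarrow> 'i" where
  "idx a = (THE i. i \<in> I \<and> a \<in> Qc i)"

lemma idx_eqI: "\<lbrakk>i \<in> I; a \<in> Qc i\<rbrakk> \<Longrightarrow> idx a = i"
  unfolding idx_def by (rule the_equality) (auto intro: Qc_unique)

lemma idx: "a \<in> carrier Q \<Longrightarrow> idx a \<in> I" "a \<in> carrier Q \<Longrightarrow> a \<in> Qc (idx a)"
  using Qc_cover[of a] idx_eqI by auto

lemma idx_q [simp]: "i \<in> I \<Longrightarrow> idx (q i) = i"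
  by (simp add: idx_eqI q_in_Qc)

lemma q_inj: "inj_on q I"
  by (metis idx_q inj_onI)

lemma idx_act [simp]:
  assumes "a \<in> carrier Q" "g \<in> carrier (Adj Q)" shows "idx (adj_act Q a g) = idx a"
  using assms by (intro idx_eqI) (auto simp: idx Qc_eq_orbit_of(2)[OF idx])

text \<open>
  A transversal for the action of \<open>Adj Q\<close>. It is normalised to be trivial at the base points, so that
  over \<open>q i\<close> the induced action below is the given one on the nose.
\<close>

definition path :: "'a \<Rightarrow> (bool \<times> 'a) list set" where
  "path a = (if a = q (idx a) then \<one>\<^bsub>Adj Q\<^esub>
    else SOME g. g \<in> carrier (Adj Q) \<and> adj_act Q (q (idx a)) g = a)"

lemma path:
  assumes a: "a \<in> carrier Q"
  shows "path a \<in> carrier (Adj Q) \<and> adj_act Q (q (idx a)) (path a) = a"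
proof (cases "a = q (idx a)")
  case True
  then show ?thesis using a by (simp add: path_def act.act_one flip: True)
next
  case False
  have "\<exists>g. g \<in> carrier (Adj Q) \<and> adj_act Q (q (idx a)) g = a"
    using idx(2)[OF a] Qc_eq[OF idx(1)[OF a]] by auto
  from someI_ex[OF this] False show ?thesis by (simp add: path_def)
qed

lemma path_closed [simp]: "a \<in> carrier Q \<Longrightarrow> path a \<in> carrier (Adj Q)"
  and adj_act_path: "a \<in> carrier Q \<Longrightarrow> adj_act Q (q (idx a)) (path a) = a"
  using path by blast+

lemma path_q [simp]: "i \<in> I \<Longrightarrow> path (q i) = \<one>\<^bsub>Adj Q\<^esub>"
  by (simp add: path_def)

lemma adj_act_inv_path: "a \<in> carrier Q \<Longrightarrow> adj_act Q a (inv\<^bsub>Adj Q\<^esub> path a) = q (idx a)"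
  using act.act_inv_right[of "q (idx a)" "path a"] by (simp add: adj_act_path idx)

text \<open>
  Walk from the base point to \<open>a\<close>, apply \<open>g\<close>, and walk back: the cocycle of the transversal, with values
  in the stabilisers of the base points.
\<close>

definition loop :: "'a \<Rightarrow> (bool \<times> 'a) list set \<Rightarrow> (bool \<times> 'a) list set" where
  "loop a g = path a \<otimes>\<^bsub>Adj Q\<^esub> g \<otimes>\<^bsub>Adj Q\<^esub> inv\<^bsub>Adj Q\<^esub> path (adj_act Q a g)"

lemma loop_stabilizer:
  assumes "a \<in> carrier Q" "g \<in> carrier (Adj Q)"
  shows "loop a g \<in> act.stabilizer (q (idx a))"
proof -
  have "adj_act Q (q (idx a)) (loop a g) = adj_act Q (adj_act Q a g) (inv\<^bsub>Adj Q\<^esub> path (adj_act Q a g))"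
    using assms by (simp add: loop_def act.act_mult act.act_closed adj_act_path idx)
  then show ?thesis
    using assms adj_act_inv_path[of "adj_act Q a g"]
    by (simp add: act.stabilizer_def act.act_closed) (simp add: loop_def act.act_closed)
qed

lemma loop_closed [simp]: "\<lbrakk>a \<in> carrier Q; g \<in> carrier (Adj Q)\<rbrakk> \<Longrightarrow> loop a g \<in> carrier (Adj Q)"
  using loop_stabilizer by (auto simp: act.stabilizer_def)

lemma loop_mult:
  "\<lbrakk>a \<in> carrier Q; g \<in> carrier (Adj Q); h \<in> carrier (Adj Q)\<rbrakk>
    \<Longrightarrow> loop a (g \<otimes>\<^bsub>Adj Q\<^esub> h) = loop a g \<otimes>\<^bsub>Adj Q\<^esub> loop (adj_act Q a g) h"
  by (simp add: loop_def act.act_closed act.act_mult Adj.m_assoc Adj.cancel_inv)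

lemma loop_one: "a \<in> carrier Q \<Longrightarrow> loop a \<one>\<^bsub>Adj Q\<^esub> = \<one>\<^bsub>Adj Q\<^esub>"
  by (simp add: loop_def act.act_one)

text \<open>
  The conjugation formula for \<open>path a\<close>. As \<open>loop_part\<close> kills the value, it makes the induced action
  satisfy \<open>x\<cdot>adj(p x) = x\<close>.
\<close>

lemma loop_adj:
  assumes "a \<in> carrier Q" shows "loop a (adj a) = adj (q (idx a))"
proof -
  have adj_a: "adj a = inv\<^bsub>Adj Q\<^esub> path a \<otimes>\<^bsub>Adj Q\<^esub> adj (q (idx a)) \<otimes>\<^bsub>Adj Q\<^esub> path a"
    using assms adj_act_conj[of "path a" "q (idx a)"] by (simp add: adj_act_path idx)
  have "path a \<otimes>\<^bsub>Adj Q\<^esub> (inv\<^bsub>Adj Q\<^esub> path a \<otimes>\<^bsub>Adj Q\<^esub> adj (q (idx a)) \<otimes>\<^bsub>Adj Q\<^esub> path a)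
      \<otimes>\<^bsub>Adj Q\<^esub> inv\<^bsub>Adj Q\<^esub> path a = adj (q (idx a))"
    using assms by (simp add: idx Adj.m_assoc Adj.cancel_inv)
  then show ?thesis
    using assms by (simp add: loop_def adj_act_adj qop_idem flip: adj_a)
qed

lemma loop_q: "\<lbrakk>i \<in> I; g \<in> carrier (Adj Q); adj_act Q (q i) g = q i\<rbrakk> \<Longrightarrow> loop (q i) g = g"
  by (simp add: loop_def)

section \<open>Morphisms of coverings and maps of fibres\<close>

text \<open>
  Each point is the translate, by \<open>path\<close> of its image, of a point in the fibre over a base point, and
  morphisms commute with translation.
\<close>

lemma covering_hom_eqI:
  assumes P: "is_covering Q P" and P': "is_covering Q P'"
    and \<phi>: "\<phi> \<in> covering_hom P P'" and \<psi>: "\<psi> \<in> covering_hom P P'"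
    and eq: "\<And>i x. \<lbrakk>i \<in> I; x \<in> fibre P (q i)\<rbrakk> \<Longrightarrow> \<phi> x = \<psi> x"
  shows "\<phi> = \<psi>"
proof (rule extensionalityI)
  show "\<phi> \<in> extensional (carrier (total P))" "\<psi> \<in> extensional (carrier (total P))"
    using \<phi> \<psi> by (auto simp: covering_hom_def qhom_def PiE_iff)
  interpret P: quandle_covering Q P by unfold_locales (rule P)
  fix x assume x: "x \<in> carrier (total P)"
  let ?a = "proj P x"
  let ?y = "monodromy Q P x (inv\<^bsub>Adj Q\<^esub> path ?a)"
  have y: "?y \<in> fibre P (q (idx ?a))"
    using x by (simp add: fibre_def P.mon.act_closed P.proj_monodromy adj_act_inv_path)
  have xy: "x = monodromy Q P ?y (path ?a)" using x by (simp add: P.mon.act_inv_left)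
  have "\<phi> x = monodromy Q P' (\<phi> ?y) (path ?a)" "\<psi> x = monodromy Q P' (\<psi> ?y) (path ?a)"
    using x y xy covering_hom_monodromy[OF P P' \<phi>, of ?y "path ?a"]
      covering_hom_monodromy[OF P P' \<psi>, of ?y "path ?a"] by (auto simp: fibre_def)
  then show "\<phi> x = \<psi> x" using eq[OF idx(1) y] x by simp
qed

text \<open>
  A point \<open>x\<close> over \<open>a\<close> is carried by \<open>path a\<close> backwards to its foot in the fibre over the base point,
  mapped by \<open>f\<close>, and carried forward again. Applying \<open>g\<close> to \<open>x\<close> changes its foot by the stabiliser
  element \<open>loop a g\<close>; equivariance of \<open>f\<close> under \<open>\<pi>\<^sub>1\<close> extends to the stabiliser since \<open>adj (q i)\<close>
  acts trivially on both fibres.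
\<close>

lemma fibre_map_extends:
  assumes P: "is_covering Q P" and P': "is_covering Q P'"
    and f: "\<And>i x. \<lbrakk>i \<in> I; x \<in> fibre P (q i)\<rbrakk> \<Longrightarrow> f x \<in> fibre P' (q i)"
    and equiv: "\<And>i x g. \<lbrakk>i \<in> I; x \<in> fibre P (q i); g \<in> carrier (\<pi>\<^sub>1 Q (q i))\<rbrakk>
      \<Longrightarrow> f (monodromy Q P x g) = monodromy Q P' (f x) g"
  shows "\<exists>\<phi> \<in> covering_hom P P'. \<forall>i \<in> I. \<forall>x \<in> fibre P (q i). \<phi> x = f x"
proof -
  interpret P: quandle_covering Q P by unfold_locales (rule P)
  interpret P': quandle_covering Q P' by unfold_locales (rule P')
  have equiv_stab: "f (monodromy Q P x s) = monodromy Q P' (f x) s"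
    if "i \<in> I" "x \<in> fibre P (q i)" "s \<in> act.stabilizer (q i)" for i x s
  proof -
    have *: "s \<in> carrier (Adj Q)" "x \<in> carrier (total P)" "proj P x = q i"
      "f x \<in> carrier (total P')" "proj P' (f x) = q i"
      using that f[OF that(1,2)] by (auto simp: act.stabilizer_def fibre_def)
    have "monodromy Q P x (loop_part (q i) s) = monodromy Q P x s"
      using * that(1) P.monodromy_adj_self[of x] by (intro loop_part_act[OF P.mon.right_action_axioms]) auto
    moreover have "monodromy Q P' (f x) (loop_part (q i) s) = monodromy Q P' (f x) s"
      using * that(1) P'.monodromy_adj_self[of "f x"] by (intro loop_part_act[OF P'.mon.right_action_axioms]) auto
    ultimately show ?thesis
      using equiv[OF that(1,2) loop_part_fundamental_group[of "q i" s]] that by simp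
  qed
  define foot where "foot x = monodromy Q P x (inv\<^bsub>Adj Q\<^esub> path (proj P x))" for x
  define \<phi> where "\<phi> = (\<lambda>x \<in> carrier (total P). monodromy Q P' (f (foot x)) (path (proj P x)))"
  have foot: "foot x \<in> fibre P (q (idx (proj P x)))" if "x \<in> carrier (total P)" for x
    using that by (simp add: foot_def fibre_def P.mon.act_closed P.proj_monodromy adj_act_inv_path)
  have f_foot: "f (foot x) \<in> carrier (total P')" "proj P' (f (foot x)) = q (idx (proj P x))"
    if "x \<in> carrier (total P)" for x
    using f[OF idx(1) foot[OF that]] that by (auto simp: fibre_def)
  have foot_mon: "foot (monodromy Q P x g) = monodromy Q P (foot x) (loop (proj P x) g)"
    if "x \<in> carrier (total P)" "g \<in> carrier (Adj Q)" for x g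
  proof -
    let ?a = "proj P x"
    have "monodromy Q P (foot x) (loop ?a g)
      = monodromy Q P (monodromy Q P (monodromy Q P (foot x) (path ?a)) g) (inv\<^bsub>Adj Q\<^esub> path (adj_act Q ?a g))"
      using that foot[OF that(1)]
      by (simp add: loop_def P.mon.act_mult P.mon.act_closed act.act_closed fibre_def)
    also have "monodromy Q P (foot x) (path ?a) = x"
      using that by (simp add: foot_def P.mon.act_inv_left)
    finally show ?thesis
      using that by (simp add: foot_def P.proj_monodromy)
  qed
  have \<phi>_closed: "\<phi> x \<in> carrier (total P')" if "x \<in> carrier (total P)" for x
    using that by (simp add: \<phi>_def f_foot P'.mon.act_closed)
  have proj_\<phi>: "proj P' (\<phi> x) = proj P x" if "x \<in> carrier (total P)" for x
    using that by (simp add: \<phi>_def f_foot P'.proj_monodromy adj_act_path)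
  have \<phi>_mon: "\<phi> (monodromy Q P x g) = monodromy Q P' (\<phi> x) g"
    if x: "x \<in> carrier (total P)" and g: "g \<in> carrier (Adj Q)" for x g
  proof -
    let ?a = "proj P x"
    have "f (foot (monodromy Q P x g)) = monodromy Q P' (f (foot x)) (loop ?a g)"
      using x g equiv_stab[OF idx(1) foot loop_stabilizer] by (simp add: foot_mon)
    then have "\<phi> (monodromy Q P x g)
        = monodromy Q P' (f (foot x)) (loop ?a g \<otimes>\<^bsub>Adj Q\<^esub> path (adj_act Q ?a g))"
      using x g by (simp add: \<phi>_def P.mon.act_closed P.proj_monodromy f_foot P'.mon.act_mult act.act_closed)
    also have "loop ?a g \<otimes>\<^bsub>Adj Q\<^esub> path (adj_act Q ?a g) = path ?a \<otimes>\<^bsub>Adj Q\<^esub> g"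
      using x g by (simp add: loop_def act.act_closed Adj.m_assoc)
    finally show ?thesis
      using x g by (simp add: \<phi>_def f_foot P'.mon.act_mult)
  qed
  have "\<phi> \<in> covering_hom P P'"
    unfolding covering_hom_def qhom_def
  proof (intro CollectI conjI ballI)
    show "\<phi> \<in> carrier (total P) \<rightarrow>\<^sub>E carrier (total P')" using \<phi>_closed by (auto simp: \<phi>_def)
    fix x y assume xy: "x \<in> carrier (total P)" "y \<in> carrier (total P)"
    have "\<phi> (x \<triangleright>\<^bsub>total P\<^esub> y) = monodromy Q P' (\<phi> x) (adj (proj P y))"
      using xy by (simp add: \<phi>_mon flip: P.monodromy_adj)
    also have "\<dots> = \<phi> x \<triangleright>\<^bsub>total P'\<^esub> \<phi> y"
      using xy P'.monodromy_adj[of "\<phi> x" "\<phi> y"] by (simp add: \<phi>_closed proj_\<phi>)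
    finally show "\<phi> (x \<triangleright>\<^bsub>total P\<^esub> y) = \<phi> x \<triangleright>\<^bsub>total P'\<^esub> \<phi> y" .
  qed (rule proj_\<phi>)
  moreover have "\<phi> x = f x" if "i \<in> I" "x \<in> fibre P (q i)" for i x
    using that f[OF that] by (auto simp: \<phi>_def foot_def fibre_def P.mon.act_one P'.mon.act_one)
  ultimately show ?thesis by blast
qed

section \<open>The covering induced by a graded action\<close>

text \<open>
  The total space consists of the pairs \<open>(x, a)\<close> with \<open>x\<close> in the piece of the component of \<open>a\<close>, coded
  in \<open>'u\<close> by \<open>J\<close>. The action is \<open>(x, a)\<cdot>g = (x\<cdot>\<kappa> a g, a\<^sup>g)\<close>, where \<open>\<kappa> a g\<close> is the loop at the base
  point that belongs to \<open>g\<close>; the cocycle rule for \<open>\<kappa>\<close> makes it an action. The identification of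
  fibres forgets \<open>a\<close>.
\<close>

lemma induced_covering:
  fixes X :: "('i, 'u, (bool \<times> 'a) list set) graded_action" and J :: "'u \<times> 'a \<Rightarrow> 'u"
  assumes X: "is_graded_action I (\<lambda>i. \<pi>\<^sub>1 Q (q i)) X"
    and J: "inj_on J (UNIV \<times> carrier Q)"
  obtains P :: "('u, 'a) covering" and e where "is_covering Q P"
    "\<And>i. i \<in> I \<Longrightarrow> bij_betw e (fibre P (q i)) (piece X i)"
    "\<And>i y g. \<lbrakk>i \<in> I; y \<in> fibre P (q i); g \<in> carrier (\<pi>\<^sub>1 Q (q i))\<rbrakk>
      \<Longrightarrow> e (monodromy Q P y g) = act X i (e y) g"
proof -
  have X_closed: "act X i x g \<in> piece X i" if "i \<in> I" "x \<in> piece X i" "g \<in> carrier (\<pi>\<^sub>1 Q (q i))" for i x g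
    using X that by (simp add: is_graded_action_def)
  have X_one: "act X i x \<one>\<^bsub>Adj Q\<^esub> = x" if "i \<in> I" "x \<in> piece X i" for i x
    using X that by (simp add: is_graded_action_def)
  have X_mult: "act X i x (g \<otimes>\<^bsub>Adj Q\<^esub> h) = act X i (act X i x g) h"
    if "i \<in> I" "x \<in> piece X i" "g \<in> carrier (\<pi>\<^sub>1 Q (q i))" "h \<in> carrier (\<pi>\<^sub>1 Q (q i))" for i x g h
    using X that by (simp add: is_graded_action_def)
  define \<kappa> where "\<kappa> a g = loop_part (q (idx a)) (loop a g)" for a g
  have \<kappa>: "\<kappa> a g \<in> carrier (\<pi>\<^sub>1 Q (q (idx a)))" if "a \<in> carrier Q" "g \<in> carrier (Adj Q)" for a g
    using that by (simp add: \<kappa>_def loop_part_fundamental_group loop_stabilizer idx)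
  have \<kappa>_mult: "\<kappa> a (g \<otimes>\<^bsub>Adj Q\<^esub> h) = \<kappa> a g \<otimes>\<^bsub>Adj Q\<^esub> \<kappa> (adj_act Q a g) h"
    if "a \<in> carrier Q" "g \<in> carrier (Adj Q)" "h \<in> carrier (Adj Q)" for a g h
    using that loop_stabilizer[of a g] loop_stabilizer[of "adj_act Q a g" h]
    by (simp add: \<kappa>_def loop_mult loop_part_mult act.act_closed idx)
  have \<kappa>_one: "\<kappa> a \<one>\<^bsub>Adj Q\<^esub> = \<one>\<^bsub>Adj Q\<^esub>" if "a \<in> carrier Q" for a
    using that by (simp add: \<kappa>_def loop_one loop_part_def adj_eps_one)
  have \<kappa>_adj: "\<kappa> a (adj a) = \<one>\<^bsub>Adj Q\<^esub>" if "a \<in> carrier Q" for a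
    using that by (simp add: \<kappa>_def loop_adj loop_part_adj idx)
  have \<kappa>_q: "\<kappa> (q i) g = g" if "i \<in> I" "g \<in> carrier (\<pi>\<^sub>1 Q (q i))" for i g
    using that loop_part_loop[of "q i" g] by (simp add: \<kappa>_def loop_q carrier_fundamental_group)
  define Z where "Z = (SIGMA x:UNIV. {a \<in> carrier Q. x \<in> piece X (idx a)})"
  have Z: "(x, a) \<in> Z \<longleftrightarrow> a \<in> carrier Q \<and> x \<in> piece X (idx a)" for x a by (auto simp: Z_def)
  define \<beta> where "\<beta> = (\<lambda>(x, a) g. (act X (idx a) x (\<kappa> a g), adj_act Q a g))"
  have \<beta>: "right_action (Adj Q) Z \<beta>"
  proof unfold_locales
    fix z g h assume z: "z \<in> Z" and g: "g \<in> carrier (Adj Q)"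
    show "\<beta> z g \<in> Z" using z g by (cases z) (auto simp: \<beta>_def Z act.act_closed X_closed \<kappa> idx)
    show "h \<in> carrier (Adj Q) \<Longrightarrow> \<beta> z (g \<otimes>\<^bsub>Adj Q\<^esub> h) = \<beta> (\<beta> z g) h"
      using z g \<kappa>[of "adj_act Q (snd z) g" h]
      by (cases z) (auto simp: \<beta>_def Z act.act_mult act.act_closed \<kappa>_mult X_mult \<kappa> idx)
  qed (auto simp: \<beta>_def Z \<kappa>_one X_one idx act.act_one)
  interpret \<beta>: right_action "Adj Q" Z \<beta> by (rule \<beta>)
  have JZ: "inj_on J Z" using J by (rule inj_on_subset) (auto simp: Z_def)
  define D where "D = inv_into Z J"
  have DJ [simp]: "z \<in> Z \<Longrightarrow> D (J z) = z" for z using JZ by (simp add: D_def)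
  define \<alpha> where "\<alpha> y g = J (\<beta> (D y) g)" for y g
  have \<alpha>: "right_action (Adj Q) (J ` Z) \<alpha>"
    by unfold_locales (auto simp: \<alpha>_def \<beta>.act_closed \<beta>.act_one \<beta>.act_mult)
  have surj: "snd ` Z = carrier Q"
  proof
    show "carrier Q \<subseteq> snd ` Z"
    proof
      fix a assume a: "a \<in> carrier Q"
      then obtain x where "x \<in> piece X (idx a)" using X idx(1) by (fastforce simp: is_graded_action_def)
      then have "(x, a) \<in> Z" using a by (simp add: Z)
      then show "a \<in> snd ` Z" by force
    qed
  qed (auto simp: Z_def)
  obtain P :: "('u, 'a) covering" where P: "is_covering Q P" "carrier (total P) = J ` Z"
    "\<And>y. y \<in> J ` Z \<Longrightarrow> proj P y = snd (D y)"
    "\<And>y g. \<lbrakk>y \<in> J ` Z; g \<in> carrier (Adj Q)\<rbrakk> \<Longrightarrow> monodromy Q P y g = \<alpha> y g"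
  proof (rule covering_of_action[OF \<alpha>, of "snd \<circ> D"])
    show "(snd \<circ> D) ` J ` Z = carrier Q" using surj by (simp add: image_image cong: image_cong)
    show "snd \<circ> D \<in> J ` Z \<rightarrow> carrier Q" by (auto simp: Z)
    fix y assume "y \<in> J ` Z"
    then obtain x a where y: "y = J (x, a)" "(x, a) \<in> Z" by auto
    show "\<alpha> y (adj ((snd \<circ> D) y)) = y"
      using y by (simp add: \<alpha>_def \<beta>_def Z \<kappa>_adj X_one idx adj_act_adj qop_idem)
    show "(snd \<circ> D) (\<alpha> y g) = adj_act Q ((snd \<circ> D) y) g" if "g \<in> carrier (Adj Q)" for g
      using y that \<beta>.act_closed[of "(x, a)" g] by (simp add: \<alpha>_def) (simp add: \<beta>_def)
  qed auto
  have fibre: "fibre P (q i) = (\<lambda>x. J (x, q i)) ` piece X i" if i: "i \<in> I" for i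
    using i by (auto simp: fibre_def P Z image_iff) (auto simp: P Z intro!: exI bexI)
  show thesis
  proof (rule that[of P "fst \<circ> D"])
    show "is_covering Q P" by (rule P)
    fix i assume i: "i \<in> I"
    have iZ: "(x, q i) \<in> Z \<longleftrightarrow> x \<in> piece X i" for x using i by (simp add: Z)
    show "bij_betw (fst \<circ> D) (fibre P (q i)) (piece X i)"
      unfolding fibre[OF i] by (rule bij_betwI[where g = "\<lambda>x. J (x, q i)"]) (auto simp: iZ)
    fix y g assume "y \<in> fibre P (q i)" and g: "g \<in> carrier (\<pi>\<^sub>1 Q (q i))"
    then obtain x where x: "y = J (x, q i)" "x \<in> piece X i" by (auto simp: fibre[OF i])
    then have xZ: "(x, q i) \<in> Z" by (simp add: iZ)
    have "g \<in> carrier (Adj Q)" using g by (simp add: carrier_fundamental_group)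
    then show "(fst \<circ> D) (monodromy Q P y g) = act X i ((fst \<circ> D) y) g"
      using x xZ i g P(4)[of y g] \<beta>.act_closed[of "(x, q i)" g]
      by (simp add: \<alpha>_def) (simp add: \<beta>_def \<kappa>_q)
  qed
qed

end

section \<open>The categories of coverings and of graded actions\<close>

lemma covering_homD:
  assumes "\<phi> \<in> covering_hom P P'"
  shows "\<phi> \<in> carrier (total P) \<rightarrow> carrier (total P')" "\<phi> \<in> extensional (carrier (total P))"
    "\<And>x. x \<in> carrier (total P) \<Longrightarrow> \<phi> x \<in> carrier (total P')"
    "\<And>x. x \<in> carrier (total P) \<Longrightarrow> proj P' (\<phi> x) = proj P x"
    "\<And>x y. \<lbrakk>x \<in> carrier (total P); y \<in> carrier (total P)\<rbrakk> \<Longrightarrow> \<phi> (x \<triangleright>\<^bsub>total P\<^esub> y) = \<phi> x \<triangleright>\<^bsub>total P'\<^esub> \<phi> y"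
  using assms by (auto simp: covering_hom_def qhom_def PiE_iff)

lemma covering_hom_Id:
  assumes "is_covering Q P" shows "(\<lambda>x \<in> carrier (total P). x) \<in> covering_hom P P"
proof -
  interpret quandle_covering Q P by unfold_locales fact
  show ?thesis by (simp add: covering_hom_def qhom_def T.qop_closed)
qed

lemma covering_hom_compose:
  assumes "is_covering Q P" "\<phi> \<in> covering_hom P P'" "\<psi> \<in> covering_hom P' P''"
  shows "compose (carrier (total P)) \<psi> \<phi> \<in> covering_hom P P''"
proof -
  interpret quandle_covering Q P by unfold_locales fact
  show ?thesis
    using covering_homD[OF assms(2)] covering_homD[OF assms(3)]
    by (simp add: covering_hom_def qhom_def T.qop_closed compose_def PiE_iff)
qed

lemma category_Cov: "category (Cov Q :: (('u, 'a) covering, 'u \<Rightarrow> 'u) cat)"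
proof
  fix X Y Z W :: "('u, 'a) covering" and f g h :: "'u \<Rightarrow> 'u"
  assume X: "X \<in> Obj (Cov Q)"
  then show "Id (Cov Q) X \<in> Hom (Cov Q) X X"
    by (auto simp: Cov_def intro: covering_hom_Id)
  assume f: "f \<in> Hom (Cov Q) X Y"
  then show "Comp (Cov Q) X X Y f (Id (Cov Q) X) = f"
    by (auto simp: Cov_def intro!: compose_Id dest: covering_homD)
  show "Comp (Cov Q) X Y Y (Id (Cov Q) Y) f = f"
    using f by (auto simp: Cov_def intro: Id_compose covering_homD)
  assume g: "g \<in> Hom (Cov Q) Y Z"
  show "Comp (Cov Q) X Y Z g f \<in> Hom (Cov Q) X Z"
    using X f g by (auto simp: Cov_def intro: covering_hom_compose)
  show "Comp (Cov Q) X Z W h (Comp (Cov Q) X Y Z g f) = Comp (Cov Q) X Y W (Comp (Cov Q) Y Z W h g) f"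
    using f by (auto simp: Cov_def intro: compose_assoc covering_homD)
qed

lemma graded_action_homD:
  assumes "f \<in> graded_action_hom I G X Y"
  shows "f \<in> (\<Union>i\<in>I. piece X i) \<rightarrow> (\<Union>i\<in>I. piece Y i)" "f \<in> extensional (\<Union>i\<in>I. piece X i)"
    "\<And>i x. \<lbrakk>i \<in> I; x \<in> piece X i\<rbrakk> \<Longrightarrow> f x \<in> piece Y i"
    "\<And>i x g. \<lbrakk>i \<in> I; x \<in> piece X i; g \<in> carrier (G i)\<rbrakk> \<Longrightarrow> f (act X i x g) = act Y i (f x) g"
  using assms by (auto simp: graded_action_hom_def PiE_iff)

lemma graded_action_homI:
  assumes "f \<in> extensional (\<Union>i\<in>I. piece X i)"
    and "\<And>i x. \<lbrakk>i \<in> I; x \<in> piece X i\<rbrakk> \<Longrightarrow> f x \<in> piece Y i"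
    and "\<And>i x g. \<lbrakk>i \<in> I; x \<in> piece X i; g \<in> carrier (G i)\<rbrakk> \<Longrightarrow> f (act X i x g) = act Y i (f x) g"
  shows "f \<in> graded_action_hom I G X Y"
  using assms by (auto simp: graded_action_hom_def PiE_iff)

lemma is_graded_action_closed:
  "\<lbrakk>is_graded_action I G X; i \<in> I; x \<in> piece X i; g \<in> carrier (G i)\<rbrakk> \<Longrightarrow> act X i x g \<in> piece X i"
  by (simp add: is_graded_action_def)

lemma graded_action_hom_Id:
  "is_graded_action I G X \<Longrightarrow> (\<lambda>x \<in> (\<Union>i\<in>I. piece X i). x) \<in> graded_action_hom I G X X"
  by (rule graded_action_homI) (auto dest: is_graded_action_closed)

lemma graded_action_hom_compose:
  assumes "is_graded_action I G X" "f \<in> graded_action_hom I G X Y" "g \<in> graded_action_hom I G Y Z"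
  shows "compose (\<Union>i\<in>I. piece X i) g f \<in> graded_action_hom I G X Z"
proof (rule graded_action_homI)
  note hom = graded_action_homD(3,4)[OF assms(2)] graded_action_homD(3,4)[OF assms(3)]
  fix i x assume x: "i \<in> I" "x \<in> piece X i"
  then have c: "compose (\<Union>i\<in>I. piece X i) g f x = g (f x)" by (auto simp: compose_def)
  with x show "compose (\<Union>i\<in>I. piece X i) g f x \<in> piece Z i" by (simp add: hom)
  fix k assume k: "k \<in> carrier (G i)"
  then have "act X i x k \<in> (\<Union>i\<in>I. piece X i)" using x is_graded_action_closed[OF assms(1)] by blast
  then show "compose (\<Union>i\<in>I. piece X i) g f (act X i x k) = act Z i (compose (\<Union>i\<in>I. piece X i) g f x) k"
    using x k c by (simp add: compose_eq hom)
qed (simp add: compose_def)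

lemma category_Act: "category (Act_I I G :: (('i, 'u, 'g) graded_action, 'u \<Rightarrow> 'u) cat)"
proof
  fix X Y Z W :: "('i, 'u, 'g) graded_action" and f g h :: "'u \<Rightarrow> 'u"
  assume X: "X \<in> Obj (Act_I I G)"
  then show "Id (Act_I I G) X \<in> Hom (Act_I I G) X X"
    by (simp add: Act_I_def graded_action_hom_Id)
  assume f: "f \<in> Hom (Act_I I G) X Y"
  then show "Comp (Act_I I G) X X Y f (Id (Act_I I G) X) = f"
    by (auto simp: Act_I_def intro!: compose_Id dest: graded_action_homD)
  show "Comp (Act_I I G) X Y Y (Id (Act_I I G) Y) f = f"
    using f by (auto simp: Act_I_def intro!: Id_compose dest: graded_action_homD)
  assume g: "g \<in> Hom (Act_I I G) Y Z"
  show "Comp (Act_I I G) X Y Z g f \<in> Hom (Act_I I G) X Z"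
    using X f g by (simp add: Act_I_def graded_action_hom_compose)
  show "Comp (Act_I I G) X Z W h (Comp (Act_I I G) X Y Z g f)
      = Comp (Act_I I G) X Y W (Comp (Act_I I G) Y Z W h g) f"
    using graded_action_homD(1)[of f I G X Y] f by (simp add: Act_I_def compose_assoc)
qed

text \<open>
  The pieces of \<open>Y\<close> are disjoint, so the bijections of the pieces assemble to a bijection of the unions,
  whose inverse is equivariant as well.
\<close>

lemma graded_action_iso:
  assumes X: "is_graded_action I G X" and Y: "is_graded_action I G Y"
    and bij: "\<And>i. i \<in> I \<Longrightarrow> bij_betw e (piece X i) (piece Y i)"
    and equiv: "\<And>i x g. \<lbrakk>i \<in> I; x \<in> piece X i; g \<in> carrier (G i)\<rbrakk> \<Longrightarrow> e (act X i x g) = act Y i (e x) g"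
  shows "is_iso (Act_I I G) X Y (restrict e (\<Union>i\<in>I. piece X i))"
proof -
  let ?U = "\<Union>i\<in>I. piece X i" and ?V = "\<Union>i\<in>I. piece Y i"
  have U: "bij_betw e ?U ?V"
    using Y bij by (intro bij_betw_UNION_disjoint) (auto simp: is_graded_action_def)
  let ?d = "inv_into ?U e"
  have d: "?d y \<in> piece X i" "e (?d y) = y" if iy: "i \<in> I" "y \<in> piece Y i" for i y
  proof -
    obtain x where "x \<in> piece X i" "e x = y" using iy(2) bij_betw_imp_surj_on[OF bij[OF iy(1)]] by (metis imageE)
    moreover from this have "?d y = x"
      using U iy by (auto simp: bij_betw_def intro: inv_into_f_eq)
    ultimately show "?d y \<in> piece X i" "e (?d y) = y" by auto
  qed
  have de: "?d (e x) = x" if "i \<in> I" "x \<in> piece X i" for i x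
    using U that by (intro inv_into_f_f) (auto simp: bij_betw_def)
  have eX: "e x \<in> piece Y i" if "i \<in> I" "x \<in> piece X i" for i x
    using bij[OF that(1)] that(2) by (auto simp: bij_betw_def)
  have "restrict e ?U \<in> graded_action_hom I G X Y"
    by (rule graded_action_homI) (auto simp: equiv eX dest: is_graded_action_closed[OF X])
  moreover have "restrict ?d ?V \<in> graded_action_hom I G Y X"
  proof (rule graded_action_homI)
    fix i y g assume *: "i \<in> I" "y \<in> piece Y i" "g \<in> carrier (G i)"
    have "e (act X i (?d y) g) = act Y i y g" using * by (simp add: equiv d)
    then have "?d (act Y i y g) = act X i (?d y) g"
      using de[OF *(1) is_graded_action_closed[OF X *(1) d(1)[OF *(1,2)] *(3)]] by simp
    moreover have "y \<in> ?V" "act Y i y g \<in> ?V" using * is_graded_action_closed[OF Y *] by blast+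
    ultimately show "restrict ?d ?V (act Y i y g) = act X i (restrict ?d ?V y) g" by simp
  qed (use d in auto)
  moreover have "compose ?U (restrict ?d ?V) (restrict e ?U) = (\<lambda>x \<in> ?U. x)"
    using de eX by (fastforce simp: compose_def restrict_def)
  moreover have "compose ?V (restrict e ?U) (restrict ?d ?V) = (\<lambda>y \<in> ?V. y)"
    using d by (fastforce simp: compose_def restrict_def)
  ultimately show ?thesis by (auto simp: is_iso_def Act_I_def)
qed

section \<open>Coverings and actions on fibres\<close>

context well_pointed_quandle
begin

lemma fibre_closed:
  assumes P: "is_covering Q P" and "i \<in> I" "x \<in> fibre P (q i)" "g \<in> carrier (\<pi>\<^sub>1 Q (q i))"
  shows "monodromy Q P x g \<in> fibre P (q i)"
proof -
  interpret quandle_covering Q P by unfold_locales (rule P)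
  show ?thesis
    using assms by (simp add: fibre_def carrier_fundamental_group mon.act_closed proj_monodromy)
qed

lemma fibre_functor_obj:
  assumes P: "is_covering Q P"
  shows "is_graded_action I (\<lambda>i. \<pi>\<^sub>1 Q (q i)) (FObj (fibre_functor Q I q) P)"
proof -
  interpret quandle_covering Q P by unfold_locales (rule P)
  have "disjoint_family_on (\<lambda>i. fibre P (q i)) I"
    using q_inj by (auto simp: disjoint_family_on_def fibre_def dest: inj_onD)
  moreover have "fibre P (q i) \<noteq> {}" if "i \<in> I" for i
    using that proj_surj[of "q i"] by (auto simp: fibre_def)
  ultimately show ?thesis
    using fibre_closed[OF P]
    by (auto simp: is_graded_action_def fibre_functor_def group_fundamental_group
        fibre_def carrier_fundamental_group mon.act_one mon.act_mult)
qed

lemma fibre_functor_hom: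
  assumes P: "is_covering Q P" and P': "is_covering Q P'" and \<phi>: "\<phi> \<in> covering_hom P P'"
  shows "FHom (fibre_functor Q I q) P P' \<phi> \<in> graded_action_hom I (\<lambda>i. \<pi>\<^sub>1 Q (q i))
    (FObj (fibre_functor Q I q) P) (FObj (fibre_functor Q I q) P')"
proof (rule graded_action_homI)
  fix i x assume x: "i \<in> I" "x \<in> piece (FObj (fibre_functor Q I q) P) i"
  then show "FHom (fibre_functor Q I q) P P' \<phi> x \<in> piece (FObj (fibre_functor Q I q) P') i"
    using covering_homD(3,4)[OF \<phi>] by (auto simp: fibre_functor_def fibre_def)
  fix g assume g: "g \<in> carrier (\<pi>\<^sub>1 Q (q i))"
  show "FHom (fibre_functor Q I q) P P' \<phi> (act (FObj (fibre_functor Q I q) P) i x g)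
      = act (FObj (fibre_functor Q I q) P') i (FHom (fibre_functor Q I q) P P' \<phi> x) g"
    using x g fibre_closed[OF P x(1) _ g] covering_hom_monodromy[OF P P' \<phi>, of x g]
    by (auto simp: fibre_functor_def fibre_def carrier_fundamental_group)
qed (auto simp: fibre_functor_def)

theorem is_functor_fibre_functor:
  "is_functor (Cov Q :: (('u, 'a) covering, 'u \<Rightarrow> 'u) cat) (Act_I I (\<lambda>i. \<pi>\<^sub>1 Q (q i))) (fibre_functor Q I q)"
proof (intro is_functor.intro is_functor_axioms.intro category_Cov category_Act)
  fix X Y Z :: "('u, 'a) covering" and f g :: "'u \<Rightarrow> 'u"
  assume X: "X \<in> Obj (Cov Q)"
  then show "FObj (fibre_functor Q I q) X \<in> Obj (Act_I I (\<lambda>i. \<pi>\<^sub>1 Q (q i)))"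
    by (simp add: Cov_def Act_I_def fibre_functor_obj)
  show "FHom (fibre_functor Q I q) X X (Id (Cov Q) X)
      = Id (Act_I I (\<lambda>i. \<pi>\<^sub>1 Q (q i))) (FObj (fibre_functor Q I q) X)"
    by (auto simp: Cov_def Act_I_def fibre_functor_def fibre_def)
  assume Y: "Y \<in> Obj (Cov Q)" and f: "f \<in> Hom (Cov Q) X Y"
  then show "FHom (fibre_functor Q I q) X Y f
      \<in> Hom (Act_I I (\<lambda>i. \<pi>\<^sub>1 Q (q i))) (FObj (fibre_functor Q I q) X) (FObj (fibre_functor Q I q) Y)"
    using X by (simp add: Cov_def Act_I_def fibre_functor_hom)
  show "FHom (fibre_functor Q I q) X Z (Comp (Cov Q) X Y Z g f)
      = Comp (Act_I I (\<lambda>i. \<pi>\<^sub>1 Q (q i))) (FObj (fibre_functor Q I q) X) (FObj (fibre_functor Q I q) Y)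
          (FObj (fibre_functor Q I q) Z) (FHom (fibre_functor Q I q) Y Z g) (FHom (fibre_functor Q I q) X Y f)"
    using covering_homD(3,4)[of f X Y] f
    by (auto simp: Cov_def Act_I_def fibre_functor_def fibre_def compose_def fun_eq_iff)
qed

theorem fibre_functor_equivalence:
  fixes J :: "'u \<times> 'a \<Rightarrow> 'u"
  assumes J: "inj_on J (UNIV \<times> carrier Q)"
  shows "\<exists>G \<eta> \<epsilon>. cat_equivalence (Cov Q :: (('u, 'a) covering, 'u \<Rightarrow> 'u) cat)
    (Act_I I (\<lambda>i. \<pi>\<^sub>1 Q (q i))) (fibre_functor Q I q) G \<eta> \<epsilon>"
proof (rule is_functor.equivalence_if_fully_faithful_ess_surj[OF is_functor_fibre_functor])
  fix P P' :: "('u, 'a) covering" and \<phi> \<psi> f :: "'u \<Rightarrow> 'u"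
  assume "P \<in> Obj (Cov Q)" "P' \<in> Obj (Cov Q)"
  then have P: "is_covering Q P" and P': "is_covering Q P'" by (simp_all add: Cov_def)
  show "\<phi> = \<psi>"
    if "\<phi> \<in> Hom (Cov Q) P P'" "\<psi> \<in> Hom (Cov Q) P P'"
      and eq: "FHom (fibre_functor Q I q) P P' \<phi> = FHom (fibre_functor Q I q) P P' \<psi>"
  proof (rule covering_hom_eqI[OF P P'])
    show "\<phi> \<in> covering_hom P P'" "\<psi> \<in> covering_hom P P'" using that by (simp_all add: Cov_def)
    show "\<phi> x = \<psi> x" if "i \<in> I" "x \<in> fibre P (q i)" for i x
      using fun_cong[OF eq, of x] that by (auto simp: fibre_functor_def split: if_splits)
  qed
  assume "f \<in> Hom (Act_I I (\<lambda>i. \<pi>\<^sub>1 Q (q i))) (FObj (fibre_functor Q I q) P) (FObj (fibre_functor Q I q) P')"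
  then have f: "f \<in> graded_action_hom I (\<lambda>i. \<pi>\<^sub>1 Q (q i)) (FObj (fibre_functor Q I q) P) (FObj (fibre_functor Q I q) P')"
    by (simp add: Act_I_def)
  obtain \<phi> where \<phi>: "\<phi> \<in> covering_hom P P'" "\<forall>i \<in> I. \<forall>x \<in> fibre P (q i). \<phi> x = f x"
    using fibre_map_extends[OF P P', of f] graded_action_homD(3,4)[OF f]
    by (auto simp: fibre_functor_def)
  have "FHom (fibre_functor Q I q) P P' \<phi> = f"
  proof (rule extensionalityI[of _ "\<Union>i\<in>I. fibre P (q i)"])
    show "f \<in> extensional (\<Union>i\<in>I. fibre P (q i))"
      using graded_action_homD(2)[OF f] by (simp add: fibre_functor_def)
  qed (use \<phi> in \<open>auto simp: fibre_functor_def\<close>)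
  then show "\<exists>\<phi> \<in> Hom (Cov Q) P P'. FHom (fibre_functor Q I q) P P' \<phi> = f"
    using \<phi>(1) by (auto simp: Cov_def)
next
  fix X :: "('i, 'u, (bool \<times> 'a) list set) graded_action"
  assume "X \<in> Obj (Act_I I (\<lambda>i. \<pi>\<^sub>1 Q (q i)))"
  then have X: "is_graded_action I (\<lambda>i. \<pi>\<^sub>1 Q (q i)) X" by (simp add: Act_I_def)
  obtain P :: "('u, 'a) covering" and e where P: "is_covering Q P"
    "\<And>i. i \<in> I \<Longrightarrow> bij_betw e (fibre P (q i)) (piece X i)"
    "\<And>i y g. \<lbrakk>i \<in> I; y \<in> fibre P (q i); g \<in> carrier (\<pi>\<^sub>1 Q (q i))\<rbrakk>
      \<Longrightarrow> e (monodromy Q P y g) = act X i (e y) g"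
    using induced_covering[OF X J] by metis
  have "is_iso (Act_I I (\<lambda>i. \<pi>\<^sub>1 Q (q i))) (FObj (fibre_functor Q I q) P) X
      (restrict e (\<Union>i\<in>I. piece (FObj (fibre_functor Q I q) P) i))"
    by (rule graded_action_iso[OF fibre_functor_obj[OF P(1)] X]) (use P in \<open>auto simp: fibre_functor_def\<close>)
  then show "\<exists>P \<in> Obj (Cov Q). \<exists>e. is_iso (Act_I I (\<lambda>i. \<pi>\<^sub>1 Q (q i))) (FObj (fibre_functor Q I q) P) X e"
    using P(1) by (auto simp: Cov_def)
qed

end

section \<open>Well-pointed coverings and graded subgroups\<close>

lemma category_Cov_I: "category (Cov_I Q I Qc q :: (('u, 'a, 'i) pointed_covering, 'u \<Rightarrow> 'u) cat)"
proof
  fix X Y Z W :: "('u, 'a, 'i) pointed_covering" and f g h :: "'u \<Rightarrow> 'u"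
  let ?C = "Cov_I Q I Qc q :: (('u, 'a, 'i) pointed_covering, 'u \<Rightarrow> 'u) cat"
  assume X: "X \<in> Obj ?C"
  then show "Id ?C X \<in> Hom ?C X X"
    by (auto simp: Cov_I_def is_pointed_covering_def PiE_iff intro: covering_hom_Id)
  assume f: "f \<in> Hom ?C X Y"
  then show "Comp ?C X X Y f (Id ?C X) = f"
    by (auto simp: Cov_I_def intro!: compose_Id dest: covering_homD)
  show "Comp ?C X Y Y (Id ?C Y) f = f"
    using f by (auto simp: Cov_I_def intro: Id_compose covering_homD)
  assume g: "g \<in> Hom ?C Y Z"
  show "Comp ?C X Y Z g f \<in> Hom ?C X Z"
    using X f g
    by (auto simp: Cov_I_def is_pointed_covering_def PiE_iff compose_eq intro: covering_hom_compose)
  show "Comp ?C X Z W h (Comp ?C X Y Z g f) = Comp ?C X Y W (Comp ?C Y Z W h g) f"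
    using f by (auto simp: Cov_I_def intro: compose_assoc covering_homD)
qed

lemma category_Sub_I: "category (Sub_I I G)"
proof
  fix K L M N f g h
  show "Id (Sub_I I G) K \<in> Hom (Sub_I I G) K K" by (simp add: Sub_I_def)
  assume f: "f \<in> Hom (Sub_I I G) K L"
  then have KL: "K \<subseteq> L" "f = (\<lambda>x \<in> K. x)" by (auto simp: Sub_I_def split: if_splits)
  then show "Comp (Sub_I I G) K K L f (Id (Sub_I I G) K) = f"
    and "Comp (Sub_I I G) K L L (Id (Sub_I I G) L) f = f"
    by (auto simp: Sub_I_def compose_def intro!: ext)
  assume g: "g \<in> Hom (Sub_I I G) L M"
  with KL have KLM: "K \<subseteq> L" "L \<subseteq> M" "f = (\<lambda>x \<in> K. x)" "g = (\<lambda>x \<in> L. x)"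
    by (auto simp: Sub_I_def split: if_splits)
  then have "compose K g f = (\<lambda>x \<in> K. x)" by (auto simp: compose_def intro!: ext)
  with KLM show "Comp (Sub_I I G) K L M g f \<in> Hom (Sub_I I G) K M" by (auto simp: Sub_I_def)
  show "Comp (Sub_I I G) K M N h (Comp (Sub_I I G) K L M g f)
      = Comp (Sub_I I G) K L N (Comp (Sub_I I G) L M N h g) f"
    using KLM by (auto simp: Sub_I_def compose_def intro!: ext)
qed

context well_pointed_quandle
begin

text \<open>
  An element of \<open>Adj(Q)\<close> lifts to the adjoint group of the total space; the lift has the same
  degree \<open>\<epsilon>\<close> and moves \<open>b\<close> in the same way. If \<open>b\<close> is fixed then so is its image in \<open>Q\<close>.
\<close>

lemma image_eq_stabilizer:
  assumes P: "is_covering Q P" and b: "b \<in> carrier (total P)"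
  shows "adj_map (total P) Q (proj P) ` carrier (\<pi>\<^sub>1 (total P) b)
    = {g \<in> carrier (\<pi>\<^sub>1 Q (proj P b)). monodromy Q P b g = b}"
proof -
  interpret quandle_covering Q P by unfold_locales (rule P)
  show ?thesis
  proof (intro equalityI subsetI)
    fix g assume "g \<in> adj_map (total P) Q (proj P) ` carrier (\<pi>\<^sub>1 (total P) b)"
    then obtain h where h: "h \<in> carrier (Adj (total P))" "adj_eps h = 0" "adj_act (total P) b h = b"
      "g = adj_map (total P) Q (proj P) h" by (auto simp: T.carrier_fundamental_group)
    then have "monodromy Q P b g = b" "g \<in> carrier (Adj Q)" "adj_eps g = 0"
      using b by (simp_all add: adj_act_total_eq_monodromy adj_map_closed adj_eps_adj_map)
    with b proj_monodromy[of b g] show "g \<in> {g \<in> carrier (\<pi>\<^sub>1 Q (proj P b)). monodromy Q P b g = b}"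
      by (simp add: carrier_fundamental_group)
  next
    fix g assume g: "g \<in> {g \<in> carrier (\<pi>\<^sub>1 Q (proj P b)). monodromy Q P b g = b}"
    then obtain h where h: "h \<in> carrier (Adj (total P))" "adj_map (total P) Q (proj P) h = g"
      using adj_map_surj by (auto simp: carrier_fundamental_group)
    with g b have "h \<in> carrier (\<pi>\<^sub>1 (total P) b)"
      using adj_eps_adj_map[OF h(1)]
      by (simp add: T.carrier_fundamental_group carrier_fundamental_group adj_act_total_eq_monodromy)
    with h show "g \<in> adj_map (total P) Q (proj P) ` carrier (\<pi>\<^sub>1 (total P) b)" by blast
  qed
qed

definition loop_stabilizers :: "('u, 'a, 'i) pointed_covering \<Rightarrow> 'i \<Rightarrow> (bool \<times> 'a) list set set" where
  "loop_stabilizers P i = {g \<in> carrier (\<pi>\<^sub>1 Q (q i)). monodromy Q P (base P i) g = base P i}"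

lemma pointed_coveringD:
  assumes "is_pointed_covering Q I Qc q P"
  shows "is_covering Q P" "\<And>i. i \<in> I \<Longrightarrow> base P i \<in> fibre P (q i)"
    "\<And>i. i \<in> I \<Longrightarrow> base P i \<in> carrier (total P)" "\<And>i. i \<in> I \<Longrightarrow> proj P (base P i) = q i"
  using assms by (auto simp: is_pointed_covering_def fibre_def)

lemma image_functor_obj_eq:
  assumes "is_pointed_covering Q I Qc q P"
  shows "FObj (image_functor Q I) P = (\<Pi>\<^sub>E i\<in>I. loop_stabilizers P i)"
  unfolding image_functor_def Let_def
  using pointed_coveringD[OF assms]
  by (simp add: image_eq_stabilizer loop_stabilizers_def cong: PiE_cong)

lemma fundamental_group_eq: "\<pi>\<^sub>1 Q x = Adj Q \<lparr>carrier := carrier (\<pi>\<^sub>1 Q x)\<rparr>"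
  by (simp add: fundamental_group_def)

lemma loop_stabilizers_subgroup:
  assumes "is_pointed_covering Q I Qc q P" "i \<in> I"
  shows "subgroup (loop_stabilizers P i) (\<pi>\<^sub>1 Q (q i))"
proof -
  note P = pointed_coveringD[OF assms(1)]
  interpret quandle_covering Q P by unfold_locales (rule P)
  have "loop_stabilizers P i = carrier (\<pi>\<^sub>1 Q (q i)) \<inter> mon.stabilizer (base P i)"
    by (auto simp: loop_stabilizers_def mon.stabilizer_def carrier_fundamental_group)
  then have "subgroup (loop_stabilizers P i) (Adj Q)"
    using assms(2) P by (simp add: subgroup_fundamental_group mon.stabilizer_subgroup Adj.subgroups_Inter_pair)
  then show ?thesis
    using assms(2) Adj.subgroup_incl[OF _ subgroup_fundamental_group[of "q i"], of "loop_stabilizers P i"]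
    by (subst fundamental_group_eq) (auto simp: loop_stabilizers_def)
qed

lemma loop_stabilizers_mono:
  assumes P: "is_pointed_covering Q I Qc q P" and P': "is_pointed_covering Q I Qc q P'"
    and \<phi>: "\<phi> \<in> covering_hom P P'" "\<And>i. i \<in> I \<Longrightarrow> \<phi> (base P i) = base P' i" and i: "i \<in> I"
  shows "loop_stabilizers P i \<subseteq> loop_stabilizers P' i"
  using covering_hom_monodromy[OF pointed_coveringD(1)[OF P] pointed_coveringD(1)[OF P'] \<phi>(1), of "base P i"]
    pointed_coveringD(3)[OF P i] \<phi>(2)[OF i]
  by (force simp: loop_stabilizers_def carrier_fundamental_group)

text \<open>
  A component of the total space is an orbit of \<open>Adj Q\<close>. Two points of the fibre in the same orbit differ
  by a stabiliser element, which may be replaced by its loop part; conversely every point over \<open>Qc i\<close>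
  is carried into the fibre over \<open>q i\<close> by the inverse of a path.
\<close>

lemma component_iff_transitive:
  assumes P: "is_covering Q P" and i: "i \<in> I" and b: "b \<in> fibre P (q i)"
  shows "{x \<in> carrier (total P). proj P x \<in> Qc i} \<in> qcomponents (total P)
    \<longleftrightarrow> (\<forall>x \<in> fibre P (q i). \<exists>g \<in> carrier (\<pi>\<^sub>1 Q (q i)). x = monodromy Q P b g)"
proof -
  interpret quandle_covering Q P by unfold_locales (rule P)
  let ?E = "{x \<in> carrier (total P). proj P x \<in> Qc i}" and ?orb = "monodromy Q P b ` carrier (Adj Q)"
  have b': "b \<in> carrier (total P)" "proj P b = q i" using b by (auto simp: fibre_def)
  have comps: "qcomponents (total P) = (\<lambda>x. monodromy Q P x ` carrier (Adj Q)) ` carrier (total P)"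
    by (simp add: T.qcomponents_eq_orbits orbit_total cong: image_cong)
  have "?E \<in> qcomponents (total P) \<longleftrightarrow> ?E = ?orb"
  proof
    assume "?E \<in> qcomponents (total P)"
    then obtain x where x: "x \<in> carrier (total P)" "?E = monodromy Q P x ` carrier (Adj Q)"
      by (auto simp: comps)
    moreover have "b \<in> ?E" using b' i by (simp add: q_in_Qc)
    ultimately obtain g where "g \<in> carrier (Adj Q)" "monodromy Q P x g = b" by auto
    with mon.orbit_eqI[OF x(1) b'(1)] x(2) show "?E = ?orb" by simp
  qed (use b' comps in auto)
  also have "\<dots> \<longleftrightarrow> (\<forall>x \<in> fibre P (q i). \<exists>g \<in> carrier (\<pi>\<^sub>1 Q (q i)). x = monodromy Q P b g)"
  proof (intro iffI ballI)
    fix x assume orb: "?E = ?orb" and x: "x \<in> fibre P (q i)"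
    from x have "x \<in> ?E" using i by (simp add: fibre_def q_in_Qc)
    then obtain g where g: "g \<in> carrier (Adj Q)" "x = monodromy Q P b g" using orb by auto
    then have "g \<in> act.stabilizer (q i)"
      using x b' proj_monodromy[of b g] by (simp add: act.stabilizer_def fibre_def)
    moreover have "monodromy Q P b (loop_part (q i) g) = x"
      using g b' i monodromy_adj_self[of b] by (subst loop_part_act[OF mon.right_action_axioms]) auto
    ultimately show "\<exists>g \<in> carrier (\<pi>\<^sub>1 Q (q i)). x = monodromy Q P b g"
      using i by (intro bexI[of _ "loop_part (q i) g"]) (auto simp: loop_part_fundamental_group)
  next
    assume trans: "\<forall>x \<in> fibre P (q i). \<exists>g \<in> carrier (\<pi>\<^sub>1 Q (q i)). x = monodromy Q P b g"
    show "?E = ?orb"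
    proof (intro equalityI subsetI)
      fix x assume x: "x \<in> ?E"
      then have ix: "idx (proj P x) = i" using i by (intro idx_eqI) auto
      let ?p = "path (proj P x)"
      have "monodromy Q P x (inv\<^bsub>Adj Q\<^esub> ?p) \<in> fibre P (q i)"
        using x adj_act_inv_path[of "proj P x"] by (simp add: fibre_def mon.act_closed proj_monodromy ix)
      then obtain g where g: "g \<in> carrier (\<pi>\<^sub>1 Q (q i))" "monodromy Q P x (inv\<^bsub>Adj Q\<^esub> ?p) = monodromy Q P b g"
        using trans by blast
      then have "x = monodromy Q P b (g \<otimes>\<^bsub>Adj Q\<^esub> ?p)"
        using x b' mon.act_inv_left[of x ?p] by (simp add: mon.act_mult carrier_fundamental_group)
      then show "x \<in> ?orb"
        using g x by (auto simp: carrier_fundamental_group)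
    next
      fix x assume "x \<in> ?orb"
      then show "x \<in> ?E" using b' i by (auto simp: mon.act_closed proj_monodromy Qc_eq)
    qed
  qed
  finally show ?thesis .
qed

lemma pointed_covering_transitive:
  assumes "is_pointed_covering Q I Qc q P" "i \<in> I" "x \<in> fibre P (q i)"
  shows "\<exists>g \<in> carrier (\<pi>\<^sub>1 Q (q i)). x = monodromy Q P (base P i) g"
  using assms component_iff_transitive[OF pointed_coveringD(1)[OF assms(1)] assms(2)
      pointed_coveringD(2)[OF assms(1,2)]]
  by (simp add: is_pointed_covering_def)

text \<open>
  The fibre map sends \<open>b\<^sub>i\<cdot>g\<close> to \<open>b'\<^sub>i\<cdot>g\<close>, which is well defined by the inclusion of stabilisers; here
  \<open>b\<^sub>i\<close> and \<open>b'\<^sub>i\<close> are the base points of the two coverings.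
\<close>

lemma pointed_covering_hom_exists:
  assumes P: "is_pointed_covering Q I Qc q P" and P': "is_pointed_covering Q I Qc q P'"
    and le: "\<And>i. i \<in> I \<Longrightarrow> loop_stabilizers P i \<subseteq> loop_stabilizers P' i"
  shows "\<exists>\<phi> \<in> covering_hom P P'. \<forall>i \<in> I. \<phi> (base P i) = base P' i"
proof -
  note P1 = pointed_coveringD[OF P] and P'1 = pointed_coveringD[OF P']
  interpret P: quandle_covering Q P by unfold_locales (rule P1)
  interpret P': quandle_covering Q P' by unfold_locales (rule P'1)
  have wd: "monodromy Q P' (base P' i) g = monodromy Q P' (base P' i) h"
    if i: "i \<in> I" and g: "g \<in> carrier (\<pi>\<^sub>1 Q (q i))" and h: "h \<in> carrier (\<pi>\<^sub>1 Q (q i))"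
      and eq: "monodromy Q P (base P i) g = monodromy Q P (base P i) h" for i g h
  proof -
    interpret L: subgroup "carrier (\<pi>\<^sub>1 Q (q i))" "Adj Q" by (rule subgroup_fundamental_group) (simp add: i)
    have "g \<otimes>\<^bsub>Adj Q\<^esub> inv\<^bsub>Adj Q\<^esub> h \<in> loop_stabilizers P i"
      using P1(3)[OF i] g h eq by (simp add: loop_stabilizers_def P.mon.act_mult P.mon.act_inv_right)
    then have "g \<otimes>\<^bsub>Adj Q\<^esub> inv\<^bsub>Adj Q\<^esub> h \<in> loop_stabilizers P' i" using le[OF i] by blast
    then have "monodromy Q P' (base P' i) (g \<otimes>\<^bsub>Adj Q\<^esub> inv\<^bsub>Adj Q\<^esub> h \<otimes>\<^bsub>Adj Q\<^esub> h) = monodromy Q P' (base P' i) h"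
      using P'1(3)[OF i] g h by (subst P'.mon.act_mult) (auto simp: loop_stabilizers_def)
    then show ?thesis using g h by (simp add: Adj.m_assoc)
  qed
  define tr where "tr x = (SOME g. g \<in> carrier (\<pi>\<^sub>1 Q (proj P x)) \<and> x = monodromy Q P (base P (idx (proj P x))) g)" for x
  have tr: "tr x \<in> carrier (\<pi>\<^sub>1 Q (q i)) \<and> x = monodromy Q P (base P i) (tr x)"
    if "i \<in> I" "x \<in> fibre P (q i)" for i x
  proof -
    have *: "proj P x = q i" using that by (simp add: fibre_def)
    show ?thesis
      using someI_ex[of "\<lambda>g. g \<in> carrier (\<pi>\<^sub>1 Q (q i)) \<and> x = monodromy Q P (base P i) g"]
        pointed_covering_transitive[OF P that] that unfolding tr_def * by auto
  qed
  define f where "f x = monodromy Q P' (base P' (idx (proj P x))) (tr x)" for x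
  have f_eq: "f (monodromy Q P (base P i) g) = monodromy Q P' (base P' i) g"
    if i: "i \<in> I" and g: "g \<in> carrier (\<pi>\<^sub>1 Q (q i))" for i g
  proof -
    let ?x = "monodromy Q P (base P i) g"
    have x: "?x \<in> fibre P (q i)" using fibre_closed[OF P1(1) i P1(2)[OF i] g] .
    then have "f ?x = monodromy Q P' (base P' i) (tr ?x)" using i by (simp add: f_def fibre_def)
    also have "\<dots> = monodromy Q P' (base P' i) g" using wd[OF i, of "tr ?x" g] tr[OF i x] g by simp
    finally show ?thesis .
  qed
  have "\<exists>\<phi> \<in> covering_hom P P'. \<forall>i \<in> I. \<forall>x \<in> fibre P (q i). \<phi> x = f x"
  proof (rule fibre_map_extends[OF P1(1) P'1(1)])
    fix i x assume i: "i \<in> I" and x: "x \<in> fibre P (q i)"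
    then obtain h where h: "h \<in> carrier (\<pi>\<^sub>1 Q (q i))" "x = monodromy Q P (base P i) h"
      using pointed_covering_transitive[OF P] by blast
    then show "f x \<in> fibre P' (q i)"
      using fibre_closed[OF P'1(1) i P'1(2)[OF i]] f_eq[OF i] by simp
    fix g assume g: "g \<in> carrier (\<pi>\<^sub>1 Q (q i))"
    have "h \<otimes>\<^bsub>Adj Q\<^esub> g \<in> carrier (\<pi>\<^sub>1 Q (q i))"
      using i g h(1) subgroup.m_closed[OF subgroup_fundamental_group] by simp
    then have "f (monodromy Q P (base P i) (h \<otimes>\<^bsub>Adj Q\<^esub> g)) = monodromy Q P' (base P' i) (h \<otimes>\<^bsub>Adj Q\<^esub> g)"
      by (rule f_eq[OF i])
    then show "f (monodromy Q P x g) = monodromy Q P' (f x) g"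
      using g h P1(3)[OF i] P'1(3)[OF i] f_eq[OF i h(1)]
      by (simp add: P.mon.act_mult P'.mon.act_mult carrier_fundamental_group)
  qed
  then obtain \<phi> where \<phi>: "\<phi> \<in> covering_hom P P'" "\<forall>i \<in> I. \<forall>x \<in> fibre P (q i). \<phi> x = f x" by blast
  have "\<phi> (base P i) = base P' i" if i: "i \<in> I" for i
  proof -
    have "\<one>\<^bsub>Adj Q\<^esub> \<in> carrier (\<pi>\<^sub>1 Q (q i))"
      using i subgroup.one_closed[OF subgroup_fundamental_group] by simp
    from f_eq[OF i this] show ?thesis
      using i \<phi>(2) P1(2,3)[OF i] P'1(3)[OF i] by (simp add: P.mon.act_one P'.mon.act_one)
  qed
  with \<phi> show ?thesis by blast
qed

lemma pointed_covering_hom_unique: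
  assumes P: "is_pointed_covering Q I Qc q P" and P': "is_pointed_covering Q I Qc q P'"
    and \<phi>: "\<phi> \<in> covering_hom P P'" and \<psi>: "\<psi> \<in> covering_hom P P'"
    and eq: "\<And>i. i \<in> I \<Longrightarrow> \<phi> (base P i) = \<psi> (base P i)"
  shows "\<phi> = \<psi>"
proof (rule covering_hom_eqI[OF pointed_coveringD(1)[OF P] pointed_coveringD(1)[OF P'] \<phi> \<psi>])
  note P1 = pointed_coveringD[OF P] and P'1 = pointed_coveringD[OF P']
  fix i x assume i: "i \<in> I" and x: "x \<in> fibre P (q i)"
  then obtain g where "g \<in> carrier (Adj Q)" "x = monodromy Q P (base P i) g"
    using pointed_covering_transitive[OF P i x] by (auto simp: carrier_fundamental_group)
  then show "\<phi> x = \<psi> x"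
    using covering_hom_monodromy[OF P1(1) P'1(1) \<phi> P1(3)[OF i]]
      covering_hom_monodromy[OF P1(1) P'1(1) \<psi> P1(3)[OF i]] eq[OF i] by simp
qed

text \<open>
  The covering is induced by the action of \<open>\<pi>\<^sub>1 Q (q i)\<close> on the right cosets of \<open>H i\<close>, coded in \<open>'u\<close> by
  \<open>c\<close> together with the index so that distinct pieces are disjoint. The base points are the trivial
  cosets, whose stabilisers are the \<open>H i\<close>.
\<close>

lemma pointed_covering_exists:
  fixes J :: "'u \<times> 'a \<Rightarrow> 'u" and c :: "'i \<times> (bool \<times> 'a) list set set \<Rightarrow> 'u"
  assumes J: "inj_on J (UNIV \<times> carrier Q)"
    and c: "inj_on c (SIGMA i:I. rcosets\<^bsub>\<pi>\<^sub>1 Q (q i)\<^esub> H i)"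
    and H: "\<And>i. i \<in> I \<Longrightarrow> subgroup (H i) (\<pi>\<^sub>1 Q (q i))"
  shows "\<exists>P :: ('u, 'a, 'i) pointed_covering. is_pointed_covering Q I Qc q P \<and>
    (\<forall>i \<in> I. loop_stabilizers P i = H i)"
proof -
  let ?C = "\<lambda>i. rcosets\<^bsub>\<pi>\<^sub>1 Q (q i)\<^esub> H i" and ?G = "\<lambda>i. \<pi>\<^sub>1 Q (q i)"
  have G: "group (?G i)" if "i \<in> I" for i using that by (simp add: group_fundamental_group)
  have Hsub: "H i \<subseteq> carrier (?G i)" if "i \<in> I" for i using H[OF that] by (rule subgroup.subset)
  have C: "S \<in> ?C i \<longleftrightarrow> (\<exists>g \<in> carrier (?G i). S = H i #>\<^bsub>?G i\<^esub> g)" for S i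
    by (auto simp: RCOSETS_def)
  have HC: "H i #>\<^bsub>?G i\<^esub> \<one>\<^bsub>?G i\<^esub> = H i" if "i \<in> I" for i
    using group.coset_mult_one[OF G[OF that] Hsub[OF that]] .
  have H_in_C: "H i \<in> ?C i" if "i \<in> I" for i
    using HC[OF that] monoid.one_closed[OF group.is_monoid[OF G[OF that]]] by (metis C)
  have Cmult: "(H i #>\<^bsub>?G i\<^esub> g) #>\<^bsub>?G i\<^esub> h = H i #>\<^bsub>?G i\<^esub> (g \<otimes>\<^bsub>Adj Q\<^esub> h)"
    if "i \<in> I" "g \<in> carrier (?G i)" "h \<in> carrier (?G i)" for i g h
    using group.coset_mult_assoc[OF G[OF that(1)] Hsub[OF that(1)] that(2,3)] by simp
  have Gmult: "g \<otimes>\<^bsub>Adj Q\<^esub> h \<in> carrier (?G i)"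
    if "i \<in> I" "g \<in> carrier (?G i)" "h \<in> carrier (?G i)" for i g h
    using that subgroup.m_closed[OF subgroup_fundamental_group] by simp
  let ?S = "SIGMA i:I. ?C i"
  define X :: "('i, 'u, (bool \<times> 'a) list set) graded_action" where
    "X = \<lparr>piece = (\<lambda>i. c ` ({i} \<times> ?C i)),
      act = (\<lambda>i u g. c (i, snd (inv_into ?S c u) #>\<^bsub>?G i\<^esub> g))\<rparr>"
  have pieceX: "u \<in> piece X i \<longleftrightarrow> (\<exists>g \<in> carrier (?G i). u = c (i, H i #>\<^bsub>?G i\<^esub> g))" for u i
  proof -
    have "{i} \<times> ?C i = (\<lambda>g. (i, H i #>\<^bsub>?G i\<^esub> g)) ` carrier (?G i)"
      by (auto simp: RCOSETS_def)
    then show ?thesis by (simp add: X_def image_image image_iff)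
  qed
  have actX: "act X i (c (i, H i #>\<^bsub>?G i\<^esub> g)) h = c (i, H i #>\<^bsub>?G i\<^esub> (g \<otimes>\<^bsub>Adj Q\<^esub> h))"
    if "i \<in> I" "g \<in> carrier (?G i)" "h \<in> carrier (?G i)" for i g h
  proof -
    have "(i, H i #>\<^bsub>?G i\<^esub> g) \<in> ?S" using that C by blast
    then have "inv_into ?S c (c (i, H i #>\<^bsub>?G i\<^esub> g)) = (i, H i #>\<^bsub>?G i\<^esub> g)"
      by (rule inv_into_f_f[OF c])
    then show ?thesis using that by (simp add: X_def Cmult)
  qed
  have X: "is_graded_action I ?G X"
    unfolding is_graded_action_def
  proof (intro conjI ballI)
    show "disjoint_family_on (piece X) I"
      unfolding disjoint_family_on_def
    proof (intro ballI impI)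
      fix i j assume ij: "i \<in> I" "j \<in> I" "i \<noteq> j"
      then have "({i} \<times> ?C i) \<inter> ({j} \<times> ?C j) = {}" by blast
      moreover have sub: "{i} \<times> ?C i \<subseteq> ?S" "{j} \<times> ?C j \<subseteq> ?S" using ij by blast+
      have "piece X i \<inter> piece X j = c ` (({i} \<times> ?C i) \<inter> ({j} \<times> ?C j))"
        unfolding X_def graded_action.simps by (rule inj_on_image_Int[OF c sub, symmetric])
      ultimately show "piece X i \<inter> piece X j = {}" by simp
    qed
    fix i assume i: "i \<in> I"
    show "group (?G i)" by (rule G[OF i])
    show "piece X i \<noteq> {}" using H_in_C[OF i] by (auto simp: X_def)
    fix u assume "u \<in> piece X i"
    then obtain k where k: "k \<in> carrier (?G i)" "u = c (i, H i #>\<^bsub>?G i\<^esub> k)" by (auto simp: pieceX)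
    show "act X i u \<one>\<^bsub>?G i\<^esub> = u"
      using k i subgroup.one_closed[OF subgroup_fundamental_group[of "q i"]]
        subgroup.mem_carrier[OF subgroup_fundamental_group[of "q i"]] by (simp add: actX)
    fix g assume g: "g \<in> carrier (?G i)"
    show "act X i u g \<in> piece X i" using k g i by (auto simp: actX pieceX intro: Gmult)
    fix h assume h: "h \<in> carrier (?G i)"
    show "act X i u (g \<otimes>\<^bsub>?G i\<^esub> h) = act X i (act X i u g) h"
      using k g h i subgroup.mem_carrier[OF subgroup_fundamental_group[of "q i"]]
      by (simp add: actX Gmult Adj.m_assoc)
  qed
  obtain P0 :: "('u, 'a) covering" and e where P0: "is_covering Q P0"
    and e: "\<And>i. i \<in> I \<Longrightarrow> bij_betw e (fibre P0 (q i)) (piece X i)"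
    and e_mon: "\<And>i y g. \<lbrakk>i \<in> I; y \<in> fibre P0 (q i); g \<in> carrier (?G i)\<rbrakk>
      \<Longrightarrow> e (monodromy Q P0 y g) = act X i (e y) g"
    using induced_covering[OF X J] by metis
  have e_inj: "e y = e z \<longleftrightarrow> y = z" if "i \<in> I" "y \<in> fibre P0 (q i)" "z \<in> fibre P0 (q i)" for i y z
    using inj_on_eq_iff[OF bij_betw_imp_inj_on[OF e[OF that(1)]] that(2,3)] .
  define b where "b i = inv_into (fibre P0 (q i)) e (c (i, H i))" for i
  have b: "b i \<in> fibre P0 (q i)" "e (b i) = c (i, H i)" if i: "i \<in> I" for i
  proof -
    have "c (i, H i) \<in> e ` fibre P0 (q i)"
      using H_in_C[OF i] e[OF i] by (auto simp: X_def bij_betw_def)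
    then show "b i \<in> fibre P0 (q i)" "e (b i) = c (i, H i)"
      by (auto simp: b_def inv_into_into f_inv_into_f)
  qed
  have e_b: "e (monodromy Q P0 (b i) g) = c (i, H i #>\<^bsub>?G i\<^esub> g)" if "i \<in> I" "g \<in> carrier (?G i)" for i g
    using e_mon[OF that(1) b(1)[OF that(1)] that(2)] b(2)[OF that(1)] actX[OF that(1) _ that(2), of "\<one>\<^bsub>Adj Q\<^esub>"]
      HC[OF that(1)] that subgroup.one_closed[OF subgroup_fundamental_group[of "q i"]]
      subgroup.mem_carrier[OF subgroup_fundamental_group[of "q i"]] by simp
  define P :: "('u, 'a, 'i) pointed_covering" where
    "P = \<lparr>total = total P0, proj = proj P0, base = restrict b I\<rparr>"
  have P_eqs: "is_covering Q P = is_covering Q P0" "monodromy Q P = monodromy Q P0" "fibre P = fibre P0"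
    by (simp_all add: P_def is_covering_def monodromy_def fibre_def fun_eq_iff)
  have base: "base P i = b i" if "i \<in> I" for i using that by (simp add: P_def)
  have mon_b: "monodromy Q P0 (b i) g = b i \<longleftrightarrow> g \<in> H i" if i: "i \<in> I" and g: "g \<in> carrier (?G i)" for i g
  proof -
    have "monodromy Q P0 (b i) g = b i \<longleftrightarrow> e (monodromy Q P0 (b i) g) = e (b i)"
      using e_inj[OF i fibre_closed[OF P0 i b(1)[OF i] g] b(1)[OF i]] by simp
    also have "\<dots> \<longleftrightarrow> c (i, H i #>\<^bsub>?G i\<^esub> g) = c (i, H i)" using e_b[OF i g] b[OF i] by simp
    also have "\<dots> \<longleftrightarrow> H i #>\<^bsub>?G i\<^esub> g = H i"
    proof
      assume "c (i, H i #>\<^bsub>?G i\<^esub> g) = c (i, H i)"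
      moreover have "(i, H i #>\<^bsub>?G i\<^esub> g) \<in> ?S" "(i, H i) \<in> ?S" using i g H_in_C[OF i] C by blast+
      ultimately show "H i #>\<^bsub>?G i\<^esub> g = H i" using inj_onD[OF c] by blast
    qed simp
    also have "\<dots> \<longleftrightarrow> g \<in> H i"
      using group.coset_join1[OF G[OF i] _ g H[OF i]] group.coset_join2[OF G[OF i] g H[OF i]] by blast
    finally show ?thesis .
  qed
  have "is_pointed_covering Q I Qc q P"
    unfolding is_pointed_covering_def
  proof (intro conjI ballI)
    show cov: "is_covering Q P" using P0 by (simp add: P_eqs)
    show "base P \<in> I \<rightarrow>\<^sub>E carrier (total P)" using b by (auto simp: P_def fibre_def)
    fix i assume i: "i \<in> I"
    show "proj P (base P i) = q i" using b[OF i] i by (simp add: P_def fibre_def)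
    have "\<exists>g \<in> carrier (?G i). x = monodromy Q P (b i) g" if x: "x \<in> fibre P (q i)" for x
    proof -
      have "e x \<in> piece X i" using x e[OF i] by (auto simp: P_eqs bij_betw_def)
      then obtain g where g: "g \<in> carrier (?G i)" "e x = e (monodromy Q P0 (b i) g)"
        using e_b[OF i] by (auto simp: pieceX)
      then have "x = monodromy Q P0 (b i) g"
        using e_inj[OF i _ fibre_closed[OF P0 i b(1)[OF i] g(1)]] x by (simp add: P_eqs)
      with g show ?thesis by (auto simp: P_eqs)
    qed
    then show "{x \<in> carrier (total P). proj P x \<in> Qc i} \<in> qcomponents (total P)"
      using component_iff_transitive[OF cov i, of "b i"] b(1)[OF i] by (simp add: P_eqs)
  qed
  moreover have "loop_stabilizers P i = H i" if "i \<in> I" for i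
    using mon_b[OF that] Hsub[OF that] by (auto simp: loop_stabilizers_def P_eqs base[OF that])
  ultimately show ?thesis by blast
qed

theorem is_functor_image_functor:
  "is_functor (Cov_I Q I Qc q :: (('u, 'a, 'i) pointed_covering, 'u \<Rightarrow> 'u) cat)
    (Sub_I I (\<lambda>i. \<pi>\<^sub>1 Q (q i))) (image_functor Q I)"
proof (intro is_functor.intro is_functor_axioms.intro category_Cov_I category_Sub_I)
  let ?C = "Cov_I Q I Qc q :: (('u, 'a, 'i) pointed_covering, 'u \<Rightarrow> 'u) cat"
  let ?D = "Sub_I I (\<lambda>i. \<pi>\<^sub>1 Q (q i))" and ?F = "image_functor Q I"
  have FHom: "FHom ?F X Y f = (\<lambda>x \<in> FObj ?F X. x)" for X Y :: "('u, 'a, 'i) pointed_covering" and f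
    by (simp add: image_functor_def Let_def)
  have mono: "FObj ?F X \<subseteq> FObj ?F Y"
    if "X \<in> Obj ?C" "Y \<in> Obj ?C" "f \<in> Hom ?C X Y" for X Y :: "('u, 'a, 'i) pointed_covering" and f
    using that loop_stabilizers_mono[of X Y f]
    by (auto simp: Cov_I_def image_functor_obj_eq intro!: PiE_mono)
  fix X Y Z :: "('u, 'a, 'i) pointed_covering" and f g :: "'u \<Rightarrow> 'u"
  assume X: "X \<in> Obj ?C"
  then show "FObj ?F X \<in> Obj ?D"
    by (auto simp: Cov_I_def Sub_I_def image_functor_obj_eq loop_stabilizers_subgroup
        intro!: exI[of _ "loop_stabilizers X"])
  show "FHom ?F X X (Id ?C X) = Id ?D (FObj ?F X)" by (simp add: FHom Sub_I_def)
  assume Y: "Y \<in> Obj ?C" and f: "f \<in> Hom ?C X Y"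
  show "FHom ?F X Y f \<in> Hom ?D (FObj ?F X) (FObj ?F Y)"
    using mono[OF X Y f] by (simp add: FHom Sub_I_def)
  show "FHom ?F X Z (Comp ?C X Y Z g f)
      = Comp ?D (FObj ?F X) (FObj ?F Y) (FObj ?F Z) (FHom ?F Y Z g) (FHom ?F X Y f)"
    using mono[OF X Y f] by (auto simp: FHom Sub_I_def compose_def fun_eq_iff)
qed

text \<open>
  The category of graded subgroups has at most one morphism between two objects, so fullness amounts to
  the existence of a pointed morphism whenever the image of the source lies in that of the target. The
  inclusion of the products gives inclusions of the factors because these are nonempty.
\<close>

theorem image_functor_equivalence:
  fixes J :: "'u \<times> 'a \<Rightarrow> 'u"
  assumes J: "inj_on J (UNIV \<times> carrier Q)"
    and c: "\<And>H. (SIGMA i:I. rcosets\<^bsub>\<pi>\<^sub>1 Q (q i)\<^esub> H i) \<lesssim> (UNIV :: 'u set)"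
  shows "\<exists>G \<eta> \<epsilon>. cat_equivalence (Cov_I Q I Qc q :: (('u, 'a, 'i) pointed_covering, 'u \<Rightarrow> 'u) cat)
    (Sub_I I (\<lambda>i. \<pi>\<^sub>1 Q (q i))) (image_functor Q I) G \<eta> \<epsilon>"
proof (rule is_functor.equivalence_if_fully_faithful_ess_surj[OF is_functor_image_functor])
  let ?C = "Cov_I Q I Qc q :: (('u, 'a, 'i) pointed_covering, 'u \<Rightarrow> 'u) cat"
  let ?D = "Sub_I I (\<lambda>i. \<pi>\<^sub>1 Q (q i))" and ?F = "image_functor Q I"
  fix X Y :: "('u, 'a, 'i) pointed_covering" and f g :: "'u \<Rightarrow> 'u"
  assume "X \<in> Obj ?C" "Y \<in> Obj ?C"
  then have X: "is_pointed_covering Q I Qc q X" and Y: "is_pointed_covering Q I Qc q Y"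
    by (simp_all add: Cov_I_def)
  show "f = g" if "f \<in> Hom ?C X Y" "g \<in> Hom ?C X Y"
    using that by (intro pointed_covering_hom_unique[OF X Y]) (auto simp: Cov_I_def)
  fix k assume k: "k \<in> Hom ?D (FObj ?F X) (FObj ?F Y)"
  then have sub: "(\<Pi>\<^sub>E i\<in>I. loop_stabilizers X i) \<subseteq> (\<Pi>\<^sub>E i\<in>I. loop_stabilizers Y i)"
    and k_eq: "k = (\<lambda>x \<in> FObj ?F X. x)"
    using X Y by (auto simp: Sub_I_def image_functor_obj_eq split: if_splits)
  have "loop_stabilizers X i \<subseteq> loop_stabilizers Y i" if "i \<in> I" for i
  proof -
    have "loop_stabilizers X j \<noteq> {}" if "j \<in> I" for j
      using subgroup.one_closed[OF loop_stabilizers_subgroup[OF X that]] by blast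
    then show ?thesis using sub that by (auto simp: PiE_eq_empty_iff subset_PiE)
  qed
  from pointed_covering_hom_exists[OF X Y this]
  obtain \<phi> where "\<phi> \<in> covering_hom X Y" "\<forall>i \<in> I. \<phi> (base X i) = base Y i" by blast
  then show "\<exists>\<phi> \<in> Hom ?C X Y. FHom ?F X Y \<phi> = k"
    by (auto simp: Cov_I_def k_eq image_functor_def Let_def intro!: bexI[of _ \<phi>])
next
  let ?C = "Cov_I Q I Qc q :: (('u, 'a, 'i) pointed_covering, 'u \<Rightarrow> 'u) cat"
  let ?D = "Sub_I I (\<lambda>i. \<pi>\<^sub>1 Q (q i))" and ?F = "image_functor Q I"
  fix K assume K: "K \<in> Obj ?D"
  then obtain H where H: "K = (\<Pi>\<^sub>E i\<in>I. H i)" "\<And>i. i \<in> I \<Longrightarrow> subgroup (H i) (\<pi>\<^sub>1 Q (q i))"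
    by (auto simp: Sub_I_def)
  obtain c' :: "'i \<times> (bool \<times> 'a) list set set \<Rightarrow> 'u" where "inj_on c' (SIGMA i:I. rcosets\<^bsub>\<pi>\<^sub>1 Q (q i)\<^esub> H i)"
    using c[of H] by (auto simp: lepoll_def)
  from pointed_covering_exists[OF J this H(2)]
  obtain P :: "('u, 'a, 'i) pointed_covering" where P: "is_pointed_covering Q I Qc q P"
    "\<And>i. i \<in> I \<Longrightarrow> loop_stabilizers P i = H i" by blast
  then have FP: "FObj ?F P = K" by (simp add: image_functor_obj_eq H(1) cong: PiE_cong)
  have "is_iso ?D K K (Id ?D K)"
    using category.Id_closed[OF category_Sub_I K] category.Id_left[OF category_Sub_I K K]
    by (auto simp: is_iso_def)
  then show "\<exists>P \<in> Obj ?C. \<exists>e. is_iso ?D (FObj ?F P) K e"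
    using P(1) FP by (auto simp: Cov_I_def)
qed

end

section \<open>The equivalences\<close>

text \<open>
  A list is coded by its length together with the nested pairing of its entries; for lists of a fixed
  length the latter is already injective.
\<close>

lemma infinite_lists_and_pairs_lepoll:
  assumes "infinite (UNIV :: 'u set)"
  shows "(UNIV :: 'u list set) \<lesssim> (UNIV :: 'u set)" and "(UNIV :: ('u \<times> 'u) set) \<lesssim> (UNIV :: 'u set)"
proof -
  have "(UNIV \<times> UNIV :: ('u \<times> 'u) set) \<approx> (UNIV :: 'u set)"
    unfolding eqpoll_iff_card_of_ordIso using assms by (rule card_of_Times_same_infinite)
  then show prod: "(UNIV :: ('u \<times> 'u) set) \<lesssim> (UNIV :: 'u set)"
    by (simp add: eqpoll_imp_lepoll)
  then obtain p :: "'u \<times> 'u \<Rightarrow> 'u" where p: "inj p" by (auto simp: lepoll_def)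
  obtain n :: "nat \<Rightarrow> 'u" where n: "inj n"
    using assms infinite_iff_countable_subset[of "UNIV :: 'u set"] by blast
  define fold where "fold = (\<lambda>xs. foldr (\<lambda>x y. p (x, y)) xs (n 0))"
  have "xs = ys" if "length xs = length ys" "fold xs = fold ys" for xs ys
    using that by (induction rule: list_induct2) (auto simp: fold_def inj_eq[OF p])
  then have "inj (\<lambda>xs. p (n (length xs), fold xs))"
    by (auto intro!: injI simp: inj_eq[OF p] inj_eq[OF n])
  then show "(UNIV :: 'u list set) \<lesssim> (UNIV :: 'u set)"
    by (auto simp: lepoll_def)
qed

theorem theorem1p27:
  fixes Q :: "'a quandle" and I :: "'i set" and Qc :: "'i \<Rightarrow> 'a set" and q :: "'i \<Rightarrow> 'a"
  assumes "well_pointed Q I Qc q"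
    and "infinite (UNIV :: 'u set)"
    and "carrier Q \<lesssim> (UNIV :: 'u set)"
  shows
    "(\<exists>G \<eta> \<epsilon>. cat_equivalence
        (Cov_I Q I Qc q :: (('u, 'a, 'i) pointed_covering, 'u \<Rightarrow> 'u) cat)
        (Sub_I I (\<lambda>i. \<pi>\<^sub>1 Q (q i)))
        (image_functor Q I) G \<eta> \<epsilon>) \<and>
     (\<exists>G \<eta> \<epsilon>. cat_equivalence
        (Cov Q :: (('u, 'a) covering, 'u \<Rightarrow> 'u) cat)
        (Act_I I (\<lambda>i. \<pi>\<^sub>1 Q (q i)) :: (('i, 'u, (bool \<times> 'a) list set) graded_action, 'u \<Rightarrow> 'u) cat)
        (fibre_functor Q I q) G \<eta> \<epsilon>)"
proof -
  interpret well_pointed_quandle Q I Qc q by unfold_locales (rule assms(1))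
  let ?U = "UNIV :: 'u set"
  note lists_U = infinite_lists_and_pairs_lepoll[OF assms(2)]
  have times_U: "A \<times> B \<lesssim> ?U" if "A \<lesssim> ?U" "B \<lesssim> ?U" for A :: "'x set" and B :: "'y set"
    using lepoll_trans[OF times_lepoll_mono[OF that]] lists_U(2) by simp
  have "?U \<times> carrier Q \<lesssim> ?U" using assms(3) by (intro times_U) auto
  then obtain J :: "'u \<times> 'a \<Rightarrow> 'u" where J: "inj_on J (?U \<times> carrier Q)"
    by (auto simp: lepoll_def)
  have I_U: "I \<lesssim> ?U"
  proof (rule lepoll_trans[OF _ assms(3)])
    show "I \<lesssim> carrier Q" using q_inj by (auto simp: lepoll_def)
  qed
  have "(UNIV :: bool set) \<lesssim> ?U" using assms(2) by (intro finite_lepoll_infinite) auto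
  then have "adj_words Q \<lesssim> lists ?U"
    unfolding adj_words_def using assms(3) by (intro lists_lepoll_mono times_U)
  then have "carrier (Adj Q) \<lesssim> lists ?U"
    unfolding Adj_def by simp (rule lepoll_trans[OF image_lepoll])
  then have Adj_U: "carrier (Adj Q) \<lesssim> ?U"
    using lists_U(1) by (simp add: lepoll_trans)
  have cosets_U: "(SIGMA i:I. rcosets\<^bsub>\<pi>\<^sub>1 Q (q i)\<^esub> H i) \<lesssim> ?U" for H
  proof (rule lepoll_trans[OF _ times_U[OF I_U Adj_U]])
    have "(SIGMA i:I. rcosets\<^bsub>\<pi>\<^sub>1 Q (q i)\<^esub> H i)
        \<subseteq> (\<lambda>(i, g). (i, H i #>\<^bsub>\<pi>\<^sub>1 Q (q i)\<^esub> g)) ` (I \<times> carrier (Adj Q))"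
      by (force simp: RCOSETS_def carrier_fundamental_group)
    then show "(SIGMA i:I. rcosets\<^bsub>\<pi>\<^sub>1 Q (q i)\<^esub> H i) \<lesssim> I \<times> carrier (Adj Q)"
      by (rule subset_image_lepoll)
  qed
  show ?thesis
    using image_functor_equivalence[OF J cosets_U] fibre_functor_equivalence[OF J] by blast
qed

end
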